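(* Let $X$ be a finite graph with vertices labeled $v_1,\dots,v_g$, $G$ a finite abelian group, $\alpha:\mathbf{E}_X\to G$ with $\alpha(\bar s)=\alpha(s)^{-1}$, and $\mathcal{G}=\{G_i\le G\}_{i=1}^g$ (with $G_i$ attached to $v_i$); let $Y=X(G,\mathcal{G},\alpha)$ with its $G$-action. For each $\psi\in\widehat G$, $$(1-u^2)^{r_0(\psi)}h(u,\psi)=z(u,\psi).$$ Moreover, if $\widetilde{\mathbf{A}}_\alpha,\widetilde{\mathbf{C}},\widetilde{\mathbf{D}}$ are obtained from $\mathbf{A}_\alpha,\mathbf{C},\mathbf{D}$ by deleting the rows and columns with indices $i$ such that $G_i\not\subseteq\ker\psi$, then $$h(u,\psi)=\det\big(\widetilde I-\psi(\widetilde{\mathbf{A}}_\alpha)\psi(\widetilde{\mathbf{C}})u+(\psi(\widetilde{\mathbf{D}})\psi(\widetilde{\mathbf{C}})-\widetilde I)u^2\big),$$ where $\widetilde I$ is the identity matrix of size $|V_X|-r_0(\psi)$.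
   Context: Graphs in Serre's sense (vertices $V$, directed edges $\mathbf{E}$, maps $o,t$, fixed-point-free involution $\varepsilon\mapsto\bar\varepsilon$ with $o(\bar\varepsilon)=t(\varepsilon)$); $\mathrm{val}(w)=|\{\varepsilon:o(\varepsilon)=w\}|$. The graph $Y=X(G,\mathcal{G},\alpha)$ has vertices $(v_i,\sigma G_i)$, directed edges $(s,\sigma)\in\mathbf{E}_X\times G$, $o(s,\sigma)=(o(s),\sigma G_{o(s)})$, $t(s,\sigma)=(t(s),\sigma\alpha(s)G_{t(s)})$, $\overline{(s,\sigma)}=(\bar s,\sigma\alpha(s))$; $G$ acts by left multiplication on the second coordinate (without inversion, freely on directed edges). $C_0(Y)=\mathbb{C}V_Y$, $\mathcal{D}(w)=\mathrm{val}_Y(w)w$, $\mathcal{A}(w)=\sum_{o(\varepsilon)=w}t(\varepsilon)$, $\eta_Y(u)=\det_{\mathbb{C}[G][u]}(\mathcal{I}-\mathcal{A}u+(\mathcal{D}-\mathcal{I})u^2)$ on $C_0(Y)[u]$ (determinant of an endomorphism $f$ of a finitely generated projective module $M$ is $\det(f\oplus\mathrm{id}_N)$ with $M\oplus N$ free); $h(u,\psi)=\psi(\eta_Y(u))$ for $\psi\in\widehat G$ (homomorphisms $G\to\mathbb{C}^\times$, extended linearly to $\mathbb{C}[G]$ and coefficientwise). $r_0(\psi)=|\{i:G_i\not\subseteq\ker\psi\}|$. Matrices in $M_g(\mathbb{Z}[G])$: $\mathbf{A}_\alpha$ with $(i,j)$ entry $\sum_{s\in\mathbf{E}_X,\,o(s)=v_j,\,t(s)=v_i}\alpha(s)$;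 $\mathbf{C}$ diagonal with $\mathbf{c}_{ii}=\sum_{h\in G_i}h$; $\mathbf{D}$ the degree matrix of $X$ (diagonal, entries $\mathrm{val}_X(v_i)$); $\mathbf{I}$ identity. $\xi_Y(u)=\det(\mathbf{I}-\mathbf{A}_\alpha\mathbf{C}u+(\mathbf{D}\mathbf{C}-\mathbf{I})u^2)$ and $z(u,\psi)=\psi(\xi_Y(u))$; $\psi$ applied to matrices entrywise. *)

theory Defs
  imports
    "HOL-Library.Poly_Mapping"
    "HOL-Analysis.Product_Vector"
    "Jordan_Normal_Form.Determinant"
    "Jordan_Normal_Form.DL_Submatrix"
begin

section \<open>Graphs in the sense of Serre\<close>

record ('v, 'e) sgraph =
  verts :: "'v set"
  dedges :: "'e set"
  orig :: "'e \<Rightarrow> 'v"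
  termin :: "'e \<Rightarrow> 'v"
  bar :: "'e \<Rightarrow> 'e"

definition serre_graph :: "('v, 'e) sgraph \<Rightarrow> bool" where
  "serre_graph X \<longleftrightarrow>
     (\<forall>e\<in>dedges X. orig X e \<in> verts X \<and> termin X e \<in> verts X \<and> bar X e \<in> dedges X \<and>
        bar X (bar X e) = e \<and> bar X e \<noteq> e \<and> orig X (bar X e) = termin X e)"

definition finite_graph :: "('v, 'e) sgraph \<Rightarrow> bool" where
  "finite_graph X \<longleftrightarrow> serre_graph X \<and> finite (verts X) \<and> finite (dedges X)"

definition val :: "('v, 'e) sgraph \<Rightarrow> 'v \<Rightarrow> nat" where
  "val X w = card {e \<in> dedges X. orig X e = w}"


section \<open>The graph \<open>X(G, \<G>, \<alpha>)\<close>\<close>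

text \<open>
  The finite abelian group \<open>G\<close> is a type of class \<open>{finite, ab_group_add}\<close>, written additively.
  The family \<open>\<G>\<close> is indexed by the vertices: \<open>H w\<close> is the subgroup attached to \<open>w\<close>.
\<close>

definition is_subgroup :: "'g::ab_group_add set \<Rightarrow> bool" where
  "is_subgroup S \<longleftrightarrow> 0 \<in> S \<and> (\<forall>a\<in>S. \<forall>b\<in>S. a + b \<in> S) \<and> (\<forall>a\<in>S. - a \<in> S)"

definition voltage :: "('v, 'e) sgraph \<Rightarrow> ('e \<Rightarrow> 'g::ab_group_add) \<Rightarrow> bool" where
  "voltage X \<alpha> \<longleftrightarrow> (\<forall>s\<in>dedges X. \<alpha> (bar X s) = - \<alpha> s)"

definition coset :: "'g::ab_group_add \<Rightarrow> 'g set \<Rightarrow> 'g set" where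
  "coset \<sigma> S = (\<lambda>h. \<sigma> + h) ` S"

definition derived_graph ::
  "('v, 'e) sgraph \<Rightarrow> ('v \<Rightarrow> 'g::ab_group_add set) \<Rightarrow> ('e \<Rightarrow> 'g) \<Rightarrow> ('v \<times> 'g set, 'e \<times> 'g) sgraph" where
  "derived_graph X H \<alpha> =
     \<lparr> verts = {(w, coset \<sigma> (H w)) | w \<sigma>. w \<in> verts X},
       dedges = dedges X \<times> UNIV,
       orig = (\<lambda>(s, \<sigma>). (orig X s, coset \<sigma> (H (orig X s)))),
       termin = (\<lambda>(s, \<sigma>). (termin X s, coset (\<sigma> + \<alpha> s) (H (termin X s)))),
       bar = (\<lambda>(s, \<sigma>). (bar X s, \<sigma> + \<alpha> s)) \<rparr>"

definition vertex_act :: "'g::ab_group_add \<Rightarrow> 'v \<times> 'g set \<Rightarrow> 'v \<times> 'g set" where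
  "vertex_act \<tau> = (\<lambda>(w, S). (w, coset \<tau> S))"

lemma serre_graph_derived_graph:
  assumes "serre_graph X" "voltage X \<alpha>"
  shows "serre_graph (derived_graph X H \<alpha>)"
proof -
  have "orig X e \<in> verts X" "termin X e \<in> verts X" "bar X e \<in> dedges X" "bar X (bar X e) = e"
    "bar X e \<noteq> e" "orig X (bar X e) = termin X e" "\<alpha> (bar X e) = - \<alpha> e"
    if "e \<in> dedges X" for e
    using assms that unfolding serre_graph_def voltage_def by blast+
  then show ?thesis
    unfolding serre_graph_def derived_graph_def by auto
qed


section \<open>Determinants of endomorphisms of finitely generated projective modules\<close>

definition pm_scale :: "'r::comm_ring_1 \<Rightarrow> ('w \<Rightarrow>\<^sub>0 'r) \<Rightarrow> ('w \<Rightarrow>\<^sub>0 'r)" where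
  "pm_scale c = Poly_Mapping.map ((*) c)"

lemma lookup_pm_scale [simp]: "Poly_Mapping.lookup (pm_scale c x) k = c * Poly_Mapping.lookup x k"
  by (simp add: pm_scale_def Poly_Mapping.map.rep_eq when_def)

lemma module_pm_scale: "Modules.module pm_scale"
  by standard (auto intro!: poly_mapping_eqI simp: lookup_add algebra_simps)

text \<open>
  \<open>is_endo_det s M N f d\<close>: the module \<open>M \<oplus> N\<close>, where \<open>M\<close> is a submodule of the ambient module
  with scalar multiplication \<open>s\<close>, has the finite basis \<open>bs\<close>, and \<open>d\<close> is the determinant of the
  matrix \<open>B\<close> of \<open>f \<oplus> id\<close> with respect to \<open>bs\<close>. If \<open>M \<oplus> N\<close> is free of finite rank,
  then \<open>N\<close> is isomorphic to a submodule of the free module \<open>nat \<Rightarrow>\<^sub>0 'r\<close>, so that taking only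
  submodules of the latter as complements loses nothing.
\<close>

definition is_endo_det ::
  "('r::comm_ring_1 \<Rightarrow> 'm::ab_group_add \<Rightarrow> 'm) \<Rightarrow> 'm set \<Rightarrow> (nat \<Rightarrow>\<^sub>0 'r) set \<Rightarrow> ('m \<Rightarrow> 'm) \<Rightarrow> 'r \<Rightarrow> bool" where
  "is_endo_det s M N f d \<longleftrightarrow>
     (let s' = module_prod.scale s pm_scale in
      \<exists>bs B. distinct bs \<and> \<not> module.dependent s' (set bs) \<and> module.span s' (set bs) = M \<times> N \<and>
        B \<in> carrier_mat (length bs) (length bs) \<and>
        (\<forall>j < length bs. map_prod f id (bs ! j) = (\<Sum>i < length bs. s' (B $$ (i, j)) (bs ! i))) \<and>
        d = det B)"

definition endo_det ::
  "('r::comm_ring_1 \<Rightarrow> 'm::ab_group_add \<Rightarrow> 'm) \<Rightarrow> 'm set \<Rightarrow> ('m \<Rightarrow> 'm) \<Rightarrow> 'r" where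
  "endo_det s M f = (THE d. \<exists>N. module.subspace pm_scale N \<and> is_endo_det s M N f d)"


section \<open>The operators on \<open>C\<^sub>0(Y)\<close> and \<open>\<eta>\<^sub>Y\<close>\<close>

definition C0 :: "('w, 'e) sgraph \<Rightarrow> ('w \<Rightarrow>\<^sub>0 complex) set" where
  "C0 Y = {x. Poly_Mapping.keys x \<subseteq> verts Y}"

definition lin_ext :: "('w \<Rightarrow> ('w \<Rightarrow>\<^sub>0 complex)) \<Rightarrow> ('w \<Rightarrow>\<^sub>0 complex) \<Rightarrow> ('w \<Rightarrow>\<^sub>0 complex)" where
  "lin_ext F x = (\<Sum>w\<in>Poly_Mapping.keys x. pm_scale (Poly_Mapping.lookup x w) (F w))"

definition deg_op :: "('w, 'e) sgraph \<Rightarrow> ('w \<Rightarrow>\<^sub>0 complex) \<Rightarrow> ('w \<Rightarrow>\<^sub>0 complex)" where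
  "deg_op Y = lin_ext (\<lambda>w. Poly_Mapping.single w (of_nat (val Y w)))"

definition adj_op :: "('w, 'e) sgraph \<Rightarrow> ('w \<Rightarrow>\<^sub>0 complex) \<Rightarrow> ('w \<Rightarrow>\<^sub>0 complex)" where
  "adj_op Y = lin_ext (\<lambda>w. \<Sum>e\<in>{e \<in> dedges Y. orig Y e = w}. Poly_Mapping.single (termin Y e) 1)"

text \<open>The group ring \<open>\<complex>[G]\<close> is the type \<open>'g \<Rightarrow>\<^sub>0 complex\<close> with the convolution product.\<close>

definition group_ring_scale ::
  "('g \<Rightarrow> 'w \<Rightarrow> 'w) \<Rightarrow> ('g \<Rightarrow>\<^sub>0 complex) \<Rightarrow> ('w \<Rightarrow>\<^sub>0 complex) \<Rightarrow> ('w \<Rightarrow>\<^sub>0 complex)" where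
  "group_ring_scale act a x =
     (\<Sum>\<tau>\<in>Poly_Mapping.keys a. \<Sum>w\<in>Poly_Mapping.keys x. Poly_Mapping.single (act \<tau> w) (Poly_Mapping.lookup a \<tau> * Poly_Mapping.lookup x w))"

text \<open>For an \<open>'r\<close>-module structure \<open>s\<close> on \<open>'m\<close>, the \<open>'r[u]\<close>-module structure on \<open>'m[u]\<close>.\<close>

definition poly_scale ::
  "('r::zero \<Rightarrow> 'm::comm_monoid_add \<Rightarrow> 'm) \<Rightarrow> 'r poly \<Rightarrow> 'm poly \<Rightarrow> 'm poly" where
  "poly_scale s p q =
     (\<Sum>i\<le>Polynomial.degree p. \<Sum>j\<le>Polynomial.degree q.
        Polynomial.monom (s (Polynomial.coeff p i) (Polynomial.coeff q j)) (i + j))"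

definition C0_poly :: "('w, 'e) sgraph \<Rightarrow> ('w \<Rightarrow>\<^sub>0 complex) poly set" where
  "C0_poly Y = {q. \<forall>n. Polynomial.coeff q n \<in> C0 Y}"

text \<open>The operator \<open>\<I> - \<A>u + (\<D> - \<I>)u\<^sup>2\<close>; multiplication by \<open>u\<close> is \<open>pCons 0\<close>.\<close>

definition ihara_op ::
  "('w, 'e) sgraph \<Rightarrow> ('w \<Rightarrow>\<^sub>0 complex) poly \<Rightarrow> ('w \<Rightarrow>\<^sub>0 complex) poly" where
  "ihara_op Y q =
     q - pCons 0 (map_poly (adj_op Y) q)
       + pCons 0 (pCons 0 (map_poly (\<lambda>x. deg_op Y x - x) q))"

definition eta ::
  "('g::ab_group_add \<Rightarrow> 'w \<Rightarrow> 'w) \<Rightarrow> ('w, 'e) sgraph \<Rightarrow> ('g \<Rightarrow>\<^sub>0 complex) poly" where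
  "eta act Y = endo_det (poly_scale (group_ring_scale act)) (C0_poly Y) (ihara_op Y)"


section \<open>Characters\<close>

definition is_character :: "('g::ab_group_add \<Rightarrow> complex) \<Rightarrow> bool" where
  "is_character \<psi> \<longleftrightarrow> (\<forall>a. \<psi> a \<noteq> 0) \<and> (\<forall>a b. \<psi> (a + b) = \<psi> a * \<psi> b)"

definition char_ker :: "('g \<Rightarrow> complex) \<Rightarrow> 'g set" where
  "char_ker \<psi> = {a. \<psi> a = 1}"

definition char_ext :: "('g \<Rightarrow> complex) \<Rightarrow> ('g \<Rightarrow>\<^sub>0 complex) \<Rightarrow> complex" where
  "char_ext \<psi> x = (\<Sum>a\<in>Poly_Mapping.keys x. Poly_Mapping.lookup x a * \<psi> a)"

text \<open>The restriction of \<open>char_ext \<psi>\<close> to \<open>\<int>[G]\<close>.\<close>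

definition char_ext_int :: "('g \<Rightarrow> complex) \<Rightarrow> ('g \<Rightarrow>\<^sub>0 int) \<Rightarrow> complex" where
  "char_ext_int \<psi> x = char_ext \<psi> (Poly_Mapping.map of_int x)"

definition h_fun ::
  "('v, 'e) sgraph \<Rightarrow> ('v \<Rightarrow> 'g::ab_group_add set) \<Rightarrow> ('e \<Rightarrow> 'g) \<Rightarrow> ('g \<Rightarrow> complex) \<Rightarrow> complex poly" where
  "h_fun X H \<alpha> \<psi> = map_poly (char_ext \<psi>) (eta vertex_act (derived_graph X H \<alpha>))"


section \<open>The matrices over \<open>\<int>[G]\<close> and \<open>\<xi>\<^sub>Y\<close>\<close>

text \<open>The vertices of \<open>X\<close> are labelled \<open>v 0, \<dots>, v (g - 1)\<close>.\<close>

definition r0 :: "nat \<Rightarrow> (nat \<Rightarrow> 'v) \<Rightarrow> ('v \<Rightarrow> 'g set) \<Rightarrow> ('g \<Rightarrow> complex) \<Rightarrow> nat" where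
  "r0 g v H \<psi> = card {i. i < g \<and> \<not> H (v i) \<subseteq> char_ker \<psi>}"

definition A_mat ::
  "nat \<Rightarrow> (nat \<Rightarrow> 'v) \<Rightarrow> ('v, 'e) sgraph \<Rightarrow> ('e \<Rightarrow> 'g::ab_group_add) \<Rightarrow> ('g \<Rightarrow>\<^sub>0 int) mat" where
  "A_mat g v X \<alpha> = mat g g (\<lambda>(i, j).
     \<Sum>s\<in>{s \<in> dedges X. orig X s = v j \<and> termin X s = v i}. Poly_Mapping.single (\<alpha> s) 1)"

definition C_mat ::
  "nat \<Rightarrow> (nat \<Rightarrow> 'v) \<Rightarrow> ('v \<Rightarrow> 'g::ab_group_add set) \<Rightarrow> ('g \<Rightarrow>\<^sub>0 int) mat" where
  "C_mat g v H = mat g g (\<lambda>(i, j). if i = j then \<Sum>a\<in>H (v i). Poly_Mapping.single a 1 else 0)"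

definition D_mat ::
  "nat \<Rightarrow> (nat \<Rightarrow> 'v) \<Rightarrow> ('v, 'e) sgraph \<Rightarrow> ('g::ab_group_add \<Rightarrow>\<^sub>0 int) mat" where
  "D_mat g v X = mat g g (\<lambda>(i, j). if i = j then of_nat (val X (v i)) else 0)"

text \<open>\<open>det(I - ACu + (DC - I)u\<^sup>2)\<close> for matrices of size \<open>n\<close>.\<close>

definition ihara_det :: "nat \<Rightarrow> 'r::comm_ring_1 mat \<Rightarrow> 'r mat \<Rightarrow> 'r mat \<Rightarrow> 'r poly" where
  "ihara_det n A C D =
     det (1\<^sub>m n - [:0, 1:] \<cdot>\<^sub>m map_mat (\<lambda>x. [:x:]) (A * C)
            + [:0, 1:]\<^sup>2 \<cdot>\<^sub>m map_mat (\<lambda>x. [:x:]) (D * C - 1\<^sub>m n))"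

definition xi ::
  "nat \<Rightarrow> (nat \<Rightarrow> 'v) \<Rightarrow> ('v, 'e) sgraph \<Rightarrow> ('v \<Rightarrow> 'g::ab_group_add set) \<Rightarrow> ('e \<Rightarrow> 'g)
     \<Rightarrow> ('g \<Rightarrow>\<^sub>0 int) poly" where
  "xi g v X H \<alpha> = ihara_det g (A_mat g v X \<alpha>) (C_mat g v H) (D_mat g v X)"

definition z_fun ::
  "nat \<Rightarrow> (nat \<Rightarrow> 'v) \<Rightarrow> ('v, 'e) sgraph \<Rightarrow> ('v \<Rightarrow> 'g::ab_group_add set) \<Rightarrow> ('e \<Rightarrow> 'g)
     \<Rightarrow> ('g \<Rightarrow> complex) \<Rightarrow> complex poly" where
  "z_fun g v X H \<alpha> \<psi> = map_poly (char_ext_int \<psi>) (xi g v X H \<alpha>)"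

definition trim :: "nat \<Rightarrow> (nat \<Rightarrow> 'v) \<Rightarrow> ('v \<Rightarrow> 'g set) \<Rightarrow> ('g \<Rightarrow> complex) \<Rightarrow> 'a mat \<Rightarrow> 'a mat" where
  "trim g v H \<psi> B =
     (let K = {i. i < g \<and> H (v i) \<subseteq> char_ker \<psi>} in submatrix B K K)"


section \<open>The scalar multiplications are module structures\<close>

lemma coset_0: "coset 0 S = S"
  by (simp add: coset_def)

lemma coset_coset: "coset a (coset b S) = coset (a + b) S"
  by (simp add: coset_def image_image add.assoc)

lemma vertex_act_0: "vertex_act 0 w = w"
  by (simp add: vertex_act_def coset_0 split: prod.split)

lemma vertex_act_add: "vertex_act (a + b) w = vertex_act a (vertex_act b w)"
  by (simp add: vertex_act_def coset_coset split: prod.split)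

lemma vertex_act_in_verts:
  "w \<in> verts (derived_graph X H \<alpha>) \<Longrightarrow> vertex_act a w \<in> verts (derived_graph X H \<alpha>)"
  by (auto simp: vertex_act_def derived_graph_def coset_coset)

lemma group_ring_scale_superset:
  assumes "finite S" "finite T" "Poly_Mapping.keys a \<subseteq> S" "Poly_Mapping.keys x \<subseteq> T"
  shows "group_ring_scale act a x = (\<Sum>\<tau>\<in>S. \<Sum>w\<in>T. Poly_Mapping.single (act \<tau> w) (Poly_Mapping.lookup a \<tau> * Poly_Mapping.lookup x w))"
proof -
  have "group_ring_scale act a x = (\<Sum>\<tau>\<in>Poly_Mapping.keys a. \<Sum>w\<in>T. Poly_Mapping.single (act \<tau> w) (Poly_Mapping.lookup a \<tau> * Poly_Mapping.lookup x w))"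
    unfolding group_ring_scale_def
    by (intro sum.cong refl sum.mono_neutral_left) (use assms in \<open>auto simp: in_keys_iff\<close>)
  also have "\<dots> = (\<Sum>\<tau>\<in>S. \<Sum>w\<in>T. Poly_Mapping.single (act \<tau> w) (Poly_Mapping.lookup a \<tau> * Poly_Mapping.lookup x w))"
    by (intro sum.mono_neutral_left) (use assms in \<open>auto simp: in_keys_iff\<close>)
  finally show ?thesis .
qed

lemma group_ring_scale_add_right: "group_ring_scale act a (x + y) = group_ring_scale act a x + group_ring_scale act a y"
proof -
  let ?T = "Poly_Mapping.keys x \<union> Poly_Mapping.keys y"
  have *: "Poly_Mapping.keys (x+y) \<subseteq> ?T" by (rule Poly_Mapping.keys_add)
  show ?thesis
    by (subst (1 2 3) group_ring_scale_superset[of "Poly_Mapping.keys a" ?T])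
       (use * in \<open>auto simp: lookup_add algebra_simps single_add sum.distrib\<close>)
qed

lemma group_ring_scale_add_left: "group_ring_scale act (a + b) x = group_ring_scale act a x + group_ring_scale act b x"
proof -
  let ?T = "Poly_Mapping.keys a \<union> Poly_Mapping.keys b"
  have *: "Poly_Mapping.keys (a+b) \<subseteq> ?T" by (rule Poly_Mapping.keys_add)
  show ?thesis
    by (subst (1 2 3) group_ring_scale_superset[of ?T "Poly_Mapping.keys x"])
       (use * in \<open>auto simp: lookup_add algebra_simps single_add sum.distrib\<close>)
qed

lemma group_ring_scale_single: "group_ring_scale act (Poly_Mapping.single \<tau> c) (Poly_Mapping.single w d) = Poly_Mapping.single (act \<tau> w) (c * d)"
  by (subst group_ring_scale_superset[of "{\<tau>}" "{w}"]) auto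

lemma poly_mapping_single_induct [case_names single sum]:
  assumes s: "\<And>k v. P (Poly_Mapping.single k v)" and a: "\<And>f g. P f \<Longrightarrow> P g \<Longrightarrow> P (f + g)"
  shows "P (x :: 'a \<Rightarrow>\<^sub>0 'b::comm_monoid_add)"
proof -
  have "P (\<Sum>k\<in>A. Poly_Mapping.single k (Poly_Mapping.lookup x k))" if "finite A" for A
    using that by induction (use s[of _ 0] s a in auto)
  from this[of "Poly_Mapping.keys x"] 
  have "P (\<Sum>k\<in>Poly_Mapping.keys x. Poly_Mapping.single k (Poly_Mapping.lookup x k))" by simp
  also have "(\<Sum>k\<in>Poly_Mapping.keys x. Poly_Mapping.single k (Poly_Mapping.lookup x k)) = x"
    by (rule poly_mapping_eqI) (auto simp: lookup_sum lookup_single when_def sum.delta in_keys_iff)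
  finally show ?thesis .
qed

lemma module_group_ring_scale:
  fixes act :: "'g::ab_group_add \<Rightarrow> 'w \<Rightarrow> 'w"
  assumes act: "\<And>w. act 0 w = w" "\<And>a b w. act (a + b) w = act a (act b w)"
  shows "Modules.module (group_ring_scale act)"
proof
  fix a b :: "'g \<Rightarrow>\<^sub>0 complex" and x y :: "'w \<Rightarrow>\<^sub>0 complex"
  have z: "group_ring_scale act 0 x = 0" "group_ring_scale act a 0 = 0" for a x
    by (auto simp: group_ring_scale_def)
  show "group_ring_scale act a (x + y) = group_ring_scale act a x + group_ring_scale act a y" by (rule group_ring_scale_add_right)
  show "group_ring_scale act (a + b) x = group_ring_scale act a x + group_ring_scale act b x" by (rule group_ring_scale_add_left)
  show "group_ring_scale act 1 x = x"
  proof (induction x rule: poly_mapping_single_induct)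
    case (single k v)
    then show ?case using group_ring_scale_single[of act 0 1 k v] by (simp add: act)
  next
    case (sum f g) then show ?case by (simp add: group_ring_scale_add_right)
  qed
  show "group_ring_scale act a (group_ring_scale act b x) = group_ring_scale act (a * b) x"
  proof (induction x rule: poly_mapping_single_induct)
    case (single k v)
    show ?case
    proof (induction b rule: poly_mapping_single_induct)
      case (single k' v')
      show ?case
        by (induction a rule: poly_mapping_single_induct)
          (simp_all add: group_ring_scale_single mult_single act mult_ac distrib_right group_ring_scale_add_left)
    next
      case sum then show ?case by (simp add: group_ring_scale_add_left group_ring_scale_add_right distrib_left)
    qed
  next
    case (sum f g) then show ?case by (simp add: group_ring_scale_add_right)
  qed
qed

lemma coeff_poly_scale:
  assumes "Modules.module s"
  shows "Polynomial.coeff (poly_scale s p q) n = (\<Sum>i\<le>n. s (Polynomial.coeff p i) (Polynomial.coeff q (n - i)))"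
proof -
  interpret s: Modules.module s by fact
  let ?f = "\<lambda>i j. s (Polynomial.coeff p i) (Polynomial.coeff q j)"
  have "Polynomial.coeff (poly_scale s p q) n = (\<Sum>i\<le>Polynomial.degree p. \<Sum>j\<le>Polynomial.degree q. if i + j = n then ?f i j else 0)"
    by (simp add: poly_scale_def Polynomial.coeff_sum)
  also have "\<dots> = (\<Sum>i\<le>Polynomial.degree p. if i \<le> n then ?f i (n - i) else 0)"
  proof (rule sum.cong[OF refl])
    fix i
    have "(\<Sum>j\<le>Polynomial.degree q. if i + j = n then ?f i j else 0) = (\<Sum>j\<le>Polynomial.degree q. if j = n - i then (if i \<le> n then ?f i j else 0) else 0)"
      by (rule sum.cong) auto
    also have "\<dots> = (if i \<le> n then ?f i (n - i) else 0)"
      by (simp add: sum.delta Polynomial.coeff_eq_0)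
    finally show "(\<Sum>j\<le>Polynomial.degree q. if i + j = n then ?f i j else 0) = (if i \<le> n then ?f i (n - i) else 0)" .
  qed
  also have "\<dots> = (\<Sum>i\<in>{..Polynomial.degree p} \<inter> {..n}. ?f i (n - i))"
    by (subst sum.inter_restrict) auto
  also have "\<dots> = (\<Sum>i\<le>n. ?f i (n - i))"
    by (rule sum.mono_neutral_left) (auto, metis Polynomial.coeff_eq_0 not_le s.scale_zero_left)
  finally show ?thesis .
qed

lemma module_poly_scale:
  assumes "Modules.module s"
  shows "Modules.module (poly_scale s)"
proof -
  interpret s: Modules.module s by fact
  note c = coeff_poly_scale[OF assms]
  show ?thesis
  proof
    fix a b :: "'a poly" and x y :: "'b poly"
    show "poly_scale s a (x + y) = poly_scale s a x + poly_scale s a y"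
      by (rule poly_eqI) (simp add: c s.scale_right_distrib sum.distrib)
    show "poly_scale s (a + b) x = poly_scale s a x + poly_scale s b x"
      by (rule poly_eqI) (simp add: c s.scale_left_distrib sum.distrib)
    show "poly_scale s 1 x = x"
    proof (rule poly_eqI)
      fix n
      have "(\<Sum>i\<le>n. s (Polynomial.coeff 1 i) (Polynomial.coeff x (n - i))) = (\<Sum>i\<le>n. if i = 0 then Polynomial.coeff x n else 0)"
        by (rule sum.cong) auto
      then show "Polynomial.coeff (poly_scale s 1 x) n = Polynomial.coeff x n" by (simp add: c)
    qed
    show "poly_scale s a (poly_scale s b x) = poly_scale s (a * b) x"
    proof (rule poly_eqI)
      fix n
      have "(\<Sum>i\<le>n. \<Sum>j\<le>n - i. s (Polynomial.coeff a i * Polynomial.coeff b j) (Polynomial.coeff x (n - i - j)))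
         = (\<Sum>k\<le>n. \<Sum>i\<le>k. s (Polynomial.coeff a i * Polynomial.coeff b (k - i)) (Polynomial.coeff x (n - k)))"
        unfolding sum.Sigma[OF finite_atMost ballI[OF finite_atMost]]
        by (rule sum.reindex_bij_witness[of _ "\<lambda>(k,i). (i, k - i)" "\<lambda>(i,j). (i + j, i)"]) auto
      then show "Polynomial.coeff (poly_scale s a (poly_scale s b x)) n = Polynomial.coeff (poly_scale s (a * b) x) n"
        by (simp add: c coeff_mult s.scale_sum_right s.scale_sum_left)
    qed
  qed
qed

lemma subspace_C0_poly:
  fixes act :: "'g::ab_group_add \<Rightarrow> 'w \<Rightarrow> 'w"
  assumes "\<And>\<tau> w. w \<in> verts Y \<Longrightarrow> act \<tau> w \<in> verts Y"
     "\<And>w. act 0 w = w" "\<And>a b w. act (a + b) w = act a (act b w)"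
  shows "module.subspace (poly_scale (group_ring_scale act)) (C0_poly Y)"
proof -
  have m: "Modules.module (group_ring_scale act)" by (rule module_group_ring_scale[OF assms(2,3)])
  interpret Modules.module "poly_scale (group_ring_scale act)" by (rule module_poly_scale[OF m])
  have C: "Poly_Mapping.keys (sum f A) \<subseteq> verts Y" if "\<And>a. a \<in> A \<Longrightarrow> Poly_Mapping.keys (f a) \<subseteq> verts Y" for f :: "'z \<Rightarrow> _ \<Rightarrow>\<^sub>0 complex" and A
    using that Poly_Mapping.keys_sum[of f A] by blast
  have g: "Poly_Mapping.keys (group_ring_scale act a x) \<subseteq> verts Y" if "Poly_Mapping.keys x \<subseteq> verts Y" for a x
    unfolding group_ring_scale_def
    using that assms(1) by (intro C) (auto split: if_splits)
  show ?thesis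
  proof (rule subspaceI)
    show "0 \<in> C0_poly Y" by (simp add: C0_poly_def C0_def)
  next
    fix p q assume "p \<in> C0_poly Y" "q \<in> C0_poly Y"
    then show "p + q \<in> C0_poly Y"
      using Poly_Mapping.keys_add[of "Polynomial.coeff p _" "Polynomial.coeff q _"]
      unfolding C0_poly_def C0_def mem_Collect_eq Polynomial.coeff_add by blast
  next
    fix c q assume "q \<in> C0_poly Y"
    then have "Poly_Mapping.keys (Polynomial.coeff q n) \<subseteq> verts Y" for n
      unfolding C0_poly_def C0_def by blast
    then show "poly_scale (group_ring_scale act) c q \<in> C0_poly Y"
      unfolding C0_poly_def C0_def coeff_poly_scale[OF m] mem_Collect_eq
      by (intro allI C g)
  qed
qed

end

theory Submission
  imports Defs "Jordan_Normal_Form.Char_Poly"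
begin

text \<open>
  As a \<open>\<complex>[G][u]\<close>-module, \<open>C\<^sub>0(Y)[u]\<close> is the direct sum over the vertices \<open>v\<^sub>i\<close> of copies of the
  ideals generated by the idempotents \<open>e\<^sub>i = 1/|G\<^sub>i| \<Sum>h\<in>G\<^sub>i. h\<close>, so the ideals of the \<open>1 - e\<^sub>i\<close>
  complete it to a free module of rank \<open>g\<close>. In the resulting basis the operator has the matrix
  \<open>1 + E (M - 1)\<close>, where \<open>E\<close> is the diagonal matrix of the \<open>e\<^sub>i\<close> and \<open>M\<close> the matrix defining \<open>\<xi>\<^sub>Y\<close>.
  A character \<open>\<psi>\<close> maps \<open>E\<close> to the projection \<open>\<pi>\<close> onto the coordinates \<open>i\<close> with \<open>\<psi>\<close> trivial on
  \<open>G\<^sub>i\<close>, and the remaining columns of \<open>M\<close> to \<open>1 - u\<^sup>2\<close> times unit vectors, so that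
  \<open>\<psi>(M) = (1 + (\<psi>(M) - 1) \<pi>) \<Delta>\<close> with \<open>\<Delta>\<close> diagonal and \<open>det \<Delta> = (1 - u\<^sup>2)^(r\<^sub>0(\<psi>))\<close>.
  The identity \<open>det (1 + AB) = det (1 + BA)\<close> does the rest: it shows that the determinant of an
  endomorphism does not depend on the complement, it gives
  \<open>det (1 + (\<psi>(M) - 1) \<pi>) = det (1 + \<pi> (\<psi>(M) - 1))\<close>, and it reduces the latter to the principal
  submatrix of \<open>\<psi>(M)\<close> when \<open>\<pi>\<close> is factored through its image.
\<close>

section \<open>Determinants over commutative rings\<close>

text \<open>
  The block determinant formulas of the library are for integral domains, which \<open>\<complex>[G][u]\<close> is not.
\<close>

lemma det_four_block_mat_one_upper_left:
  fixes B :: "'a::comm_ring_1 mat"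
  assumes "B \<in> carrier_mat n m" "D \<in> carrier_mat m m"
  shows "det (four_block_mat (1\<^sub>m n) B (0\<^sub>m m n) D) = det D"
  using assms(1)
proof (induction n arbitrary: B)
  case 0
  have "four_block_mat (1\<^sub>m 0) B (0\<^sub>m m 0) D = D"
    by (rule eq_matI) (use assms(2) 0 in auto)
  then show ?case by simp
next
  case (Suc n)
  let ?M = "four_block_mat (1\<^sub>m (Suc n)) B (0\<^sub>m m (Suc n)) D"
  let ?B' = "mat n m (\<lambda>(i, j). B $$ (Suc i, j))"
  have M: "?M \<in> carrier_mat (Suc n + m) (Suc n + m)"
    using assms(2) by auto
  have "det ?M = (\<Sum>i<Suc n + m. ?M $$ (i, 0) * cofactor ?M i 0)"
    by (rule laplace_expansion_column[OF M]) simp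
  also have "\<dots> = (\<Sum>i<Suc n + m. if i = 0 then cofactor ?M 0 0 else 0)"
    by (rule sum.cong) (use assms(2) in auto)
  also have "\<dots> = det (mat_delete ?M 0 0)"
    by (simp add: cofactor_def)
  also have "mat_delete ?M 0 0 = four_block_mat (1\<^sub>m n) ?B' (0\<^sub>m m n) D"
    by (rule eq_matI) (use assms(2) Suc.prems in \<open>auto simp: mat_delete_def\<close>)
  finally show ?case by (simp add: Suc.IH)
qed

lemma det_four_block_mat_one_lower_right:
  fixes A :: "'a::comm_ring_1 mat"
  assumes "A \<in> carrier_mat m m" "B \<in> carrier_mat m n"
  shows "det (four_block_mat A B (0\<^sub>m n m) (1\<^sub>m n)) = det A"
  using assms(2)
proof (induction n arbitrary: B)
  case 0
  have "four_block_mat A B (0\<^sub>m 0 m) (1\<^sub>m 0) = A"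
    by (rule eq_matI) (use assms(1) 0 in auto)
  then show ?case by simp
next
  case (Suc n)
  let ?M = "four_block_mat A B (0\<^sub>m (Suc n) m) (1\<^sub>m (Suc n))"
  let ?B' = "mat m n (\<lambda>(i, j). B $$ (i, j))"
  have M: "?M \<in> carrier_mat (m + Suc n) (m + Suc n)"
    using assms(1) by auto
  have "det ?M = (\<Sum>j<m + Suc n. ?M $$ (m + n, j) * cofactor ?M (m + n) j)"
    by (rule laplace_expansion_row[OF M]) simp
  also have "\<dots> = (\<Sum>j<m + Suc n. if j = m + n then cofactor ?M (m + n) (m + n) else 0)"
    by (rule sum.cong) (use assms(1) in auto)
  also have "\<dots> = det (mat_delete ?M (m + n) (m + n))"
    by (simp add: cofactor_def power_add[symmetric])
  also have "mat_delete ?M (m + n) (m + n) = four_block_mat A ?B' (0\<^sub>m n m) (1\<^sub>m n)"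
    by (rule eq_matI) (use assms(1) Suc.prems in \<open>auto simp: mat_delete_def\<close>)
  finally show ?case by (simp add: Suc.IH)
qed

text \<open>The factor \<open>[1, 0; B, 1]\<close> conjugates \<open>[1, -A; 0, 1 + BA]\<close> into \<open>[1 + AB, -A; 0, 1]\<close>.\<close>

lemma det_one_plus_mult_commute:
  fixes A :: "'a::comm_ring_1 mat"
  assumes A: "A \<in> carrier_mat n m" and B: "B \<in> carrier_mat m n"
  shows "det (1\<^sub>m n + A * B) = det (1\<^sub>m m + B * A)"
proof -
  let ?L = "four_block_mat (1\<^sub>m n) (0\<^sub>m n m) B (1\<^sub>m m)"
  let ?L' = "four_block_mat (1\<^sub>m n) (0\<^sub>m n m) (- B) (1\<^sub>m m)"
  let ?S = "four_block_mat (1\<^sub>m n + A * B) (- A) (0\<^sub>m m n) (1\<^sub>m m)"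
  let ?T = "four_block_mat (1\<^sub>m n) (- A) (0\<^sub>m m n) (1\<^sub>m m + B * A)"
  have carrier: "1\<^sub>m n + A * B \<in> carrier_mat n n" "1\<^sub>m m + B * A \<in> carrier_mat m m"
    "- A \<in> carrier_mat n m" "- B \<in> carrier_mat m n"
    using A B by auto
  have block_carrier: "?L \<in> carrier_mat (n + m) (n + m)" "?L' \<in> carrier_mat (n + m) (n + m)"
    "?S \<in> carrier_mat (n + m) (n + m)" "?T \<in> carrier_mat (n + m) (n + m)"
    using A B by auto
  note block_mult = mult_four_block_mat[of _ n n _ m _ m _ _ n _ m]
  have "- 0\<^sub>m n n = (0\<^sub>m n n :: 'a mat)" "B + - B = 0\<^sub>m m n"
    by (rule eq_matI; use B in auto)+
  then have "?L * ?L' = 1\<^sub>m (n + m)"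
    using B by (subst block_mult) auto
  then have det_L: "det ?L * det ?L' = 1"
    using det_mult[OF block_carrier(1,2)] by simp
  have "?S * ?L = four_block_mat (1\<^sub>m n) (- A) B (1\<^sub>m m)"
    using A B carrier by (subst block_mult) (auto simp: add_uminus_minus_mat)
  moreover have "?L * ?T = four_block_mat (1\<^sub>m n) (- A) B (1\<^sub>m m)"
    using A B carrier by (subst block_mult) auto
  ultimately have conjugation: "det ?S * det ?L = det ?L * det ?T"
    using det_mult[OF block_carrier(3,1)] det_mult[OF block_carrier(1,4)] by simp
  have "det ?S = det ?S * det ?L * det ?L'"
    by (simp add: det_L mult.assoc)
  also have "\<dots> = det ?L * det ?L' * det ?T"
    unfolding conjugation by (simp only: mult_ac)
  also have "\<dots> = det ?T"
    by (simp add: det_L)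
  finally show ?thesis
    using det_four_block_mat_one_upper_left[OF carrier(3,2)]
      det_four_block_mat_one_lower_right[OF carrier(1,3)] by simp
qed

section \<open>Principal submatrices\<close>

lemma bij_betw_pick:
  assumes "finite K"
  shows "bij_betw (pick K) {..<card K} K"
proof (rule bij_betw_byWitness[where f' = "\<lambda>i. card {k \<in> K. k < i}"])
  show "(\<lambda>i. card {k \<in> K. k < i}) ` K \<subseteq> {..<card K}"
  proof (rule image_subsetI)
    fix i assume "i \<in> K"
    then have "{k \<in> K. k < i} \<subset> K" by auto
    then show "card {k \<in> K. k < i} \<in> {..<card K}"
      using psubset_card_mono[OF assms] by simp
  qed
qed (auto simp: card_pick pick_card_in_set pick_in_set)

lemma submatrix_carrier:
  assumes "A \<in> carrier_mat n m" "I \<subseteq> {..<n}" "J \<subseteq> {..<m}"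
  shows "submatrix A I J \<in> carrier_mat (card I) (card J)"
proof -
  have "{i. i < n \<and> i \<in> I} = I" "{j. j < m \<and> j \<in> J} = J" using assms by auto
  then show ?thesis
    using carrier_matD[OF assms(1)] by (intro carrier_matI) (simp_all add: dim_submatrix)
qed

lemma index_submatrix:
  assumes "A \<in> carrier_mat n m" "I \<subseteq> {..<n}" "J \<subseteq> {..<m}" "i < card I" "j < card J"
  shows "submatrix A I J $$ (i, j) = A $$ (pick I i, pick J j)"
proof -
  have "{i. i < n \<and> i \<in> I} = I" "{j. j < m \<and> j \<in> J} = J" using assms by auto
  then show ?thesis using assms by (simp add: submatrix_index)
qed

lemma submatrix_eqI:
  assumes "A \<in> carrier_mat n m" "I \<subseteq> {..<n}" "J \<subseteq> {..<m}" "B \<in> carrier_mat (card I) (card J)"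
    and "\<And>i j. i < card I \<Longrightarrow> j < card J \<Longrightarrow> A $$ (pick I i, pick J j) = B $$ (i, j)"
  shows "submatrix A I J = B"
  using carrier_matD[OF submatrix_carrier[OF assms(1-3)]] assms
  by (intro eq_matI) (auto simp: index_submatrix[OF assms(1-3)])

lemma pick_less:
  assumes "K \<subseteq> {..<n}" "i < card K"
  shows "pick K i < n"
  using pick_in_set_le[OF assms(2)] assms(1) by auto

lemma pick_eq_iff:
  assumes "i < card K" "j < card K"
  shows "pick K i = pick K j \<longleftrightarrow> i = j"
  using pick_mono_le[OF assms(1), of j] pick_mono_le[OF assms(2), of i]
  by (metis less_irrefl linorder_neqE_nat)

lemma map_mat_submatrix: "map_mat f (submatrix A I J) = submatrix (map_mat f A) I J"
  by (rule eq_matI) (auto simp: submatrix_def pick_le)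

lemma det_mat_diag: "det (mat_diag n f) = (\<Prod>i<n. f i)"
proof -
  have "det (mat_diag n f) = prod_list (diag_mat (mat_diag n f))"
    by (rule det_upper_triangular[OF _ mat_diag_dim]) (auto simp: upper_triangular_def mat_diag_def)
  also have "diag_mat (mat_diag n f) = map f [0..<n]"
    by (auto simp: diag_mat_def mat_diag_def)
  finally show ?thesis by (simp add: prod.list_conv_set_nth atLeast0LessThan)
qed

lemma submatrix_mat_diag:
  assumes "K \<subseteq> {..<n}"
  shows "submatrix (mat_diag n d) K K = mat_diag (card K) (d \<circ> pick K)"
  by (rule submatrix_eqI[OF mat_diag_dim assms assms])
    (auto simp: pick_less[OF assms] pick_eq_iff mat_diag_def)

lemma submatrix_mult_mat_diag:
  assumes A: "A \<in> carrier_mat n n" and K: "K \<subseteq> {..<n}"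
  shows "submatrix (A * mat_diag n d) K K = submatrix A K K * submatrix (mat_diag n d) K K"
  unfolding submatrix_mat_diag[OF K] mat_diag_mult_right[OF A]
    mat_diag_mult_right[OF submatrix_carrier[OF A K K]]
  by (rule submatrix_eqI[OF _ K K]) (auto simp: index_submatrix[OF A K K] pick_less[OF K])

section \<open>Corners extended by the identity\<close>

definition corner_mat :: "nat \<Rightarrow> (nat \<Rightarrow> 'a::comm_ring_1) \<Rightarrow> 'a mat \<Rightarrow> 'a mat" where
  "corner_mat n E A = 1\<^sub>m n + mat_diag n E * (A - 1\<^sub>m n)"

lemma corner_mat_carrier [simp]: "corner_mat n E A \<in> carrier_mat n n"
  by (simp add: corner_mat_def mult_carrier_mat[OF mat_diag_dim] minus_carrier_mat)

lemma dim_corner_mat [simp]: "dim_row (corner_mat n E A) = n" "dim_col (corner_mat n E A) = n"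
  using corner_mat_carrier[of n E A] by (simp_all only: carrier_matD)

lemma index_corner_mat:
  assumes "A \<in> carrier_mat n n" "i < n" "j < n"
  shows "corner_mat n E A $$ (i, j)
    = (if i = j then 1 else 0) + E i * (A $$ (i, j) - (if i = j then 1 else 0))"
  using assms by (simp add: corner_mat_def mat_diag_mult_left[OF minus_carrier_mat[OF one_carrier_mat]])

lemma (in comm_ring_hom) map_corner_mat:
  assumes "A \<in> carrier_mat n n"
  shows "mat\<^sub>h (corner_mat n E A) = corner_mat n (\<lambda>i. hom (E i)) (mat\<^sub>h A)"
proof (rule eq_matI)
  fix i j
  assume "i < dim_row (corner_mat n (\<lambda>i. hom (E i)) (mat\<^sub>h A))"
    and "j < dim_col (corner_mat n (\<lambda>i. hom (E i)) (mat\<^sub>h A))"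
  then show "mat\<^sub>h (corner_mat n E A) $$ (i, j) = corner_mat n (\<lambda>i. hom (E i)) (mat\<^sub>h A) $$ (i, j)"
    using assms by (simp add: index_corner_mat hom_distribs)
qed simp_all

lemma det_one_plus_mat_diag_of_bool_mult:
  fixes A :: "'a::comm_ring_1 mat"
  assumes A: "A \<in> carrier_mat n n" and K: "K \<subseteq> {..<n}"
  shows "det (1\<^sub>m n + mat_diag n (\<lambda>i. of_bool (i \<in> K)) * A) = det (1\<^sub>m (card K) + submatrix A K K)"
proof -
  define inclusion :: "'a mat" where "inclusion = mat n (card K) (\<lambda>(i, a). of_bool (i = pick K a))"
  define rows where "rows = mat (card K) n (\<lambda>(a, j). A $$ (pick K a, j))"
  have inclusion: "inclusion \<in> carrier_mat n (card K)" and rows: "rows \<in> carrier_mat (card K) n"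
    by (auto simp: inclusion_def rows_def)
  have "finite K" using K finite_subset by blast
  have "mat_diag n (\<lambda>i. of_bool (i \<in> K)) * A = inclusion * rows"
  proof (rule eq_matI)
    fix i j assume "i < dim_row (inclusion * rows)" "j < dim_col (inclusion * rows)"
    then have ij: "i < n" "j < n" using inclusion rows by auto
    have "(inclusion * rows) $$ (i, j) = (\<Sum>a<card K. of_bool (i = pick K a) * A $$ (pick K a, j))"
      using ij by (simp add: inclusion_def rows_def scalar_prod_def atLeast0LessThan)
    also have "\<dots> = (\<Sum>k\<in>K. of_bool (i = k) * A $$ (k, j))"
      by (rule sum.reindex_bij_betw[OF bij_betw_pick[OF \<open>finite K\<close>]])
    also have "\<dots> = (\<Sum>k\<in>K. if k = i then A $$ (i, j) else 0)"
      by (rule sum.cong) auto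
    also have "\<dots> = (mat_diag n (\<lambda>i. of_bool (i \<in> K)) * A) $$ (i, j)"
      using \<open>finite K\<close> ij by (simp add: mat_diag_mult_left[OF A])
    finally show "(mat_diag n (\<lambda>i. of_bool (i \<in> K)) * A) $$ (i, j) = (inclusion * rows) $$ (i, j)"
      by simp
  qed (use A inclusion rows in \<open>auto simp: mat_diag_def\<close>)
  moreover have "rows * inclusion = submatrix A K K"
  proof (rule eq_matI)
    fix a b assume "a < dim_row (submatrix A K K)" "b < dim_col (submatrix A K K)"
    then have ab: "a < card K" "b < card K" using submatrix_carrier[OF A K K] by auto
    have "(rows * inclusion) $$ (a, b) = (\<Sum>i<n. A $$ (pick K a, i) * of_bool (i = pick K b))"
      using ab by (simp add: inclusion_def rows_def scalar_prod_def atLeast0LessThan)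
    also have "\<dots> = (\<Sum>i<n. if i = pick K b then A $$ (pick K a, pick K b) else 0)"
      by (rule sum.cong) auto
    also have "\<dots> = submatrix A K K $$ (a, b)"
      using ab by (simp add: pick_less[OF K] index_submatrix[OF A K K])
    finally show "(rows * inclusion) $$ (a, b) = submatrix A K K $$ (a, b)" .
  qed (use submatrix_carrier[OF A K K] inclusion rows in auto)
  ultimately show ?thesis
    using det_one_plus_mult_commute[OF inclusion rows] by simp
qed

lemma det_submatrix_eq_det_corner_mat:
  fixes M :: "'a::comm_ring_1 mat"
  assumes M: "M \<in> carrier_mat n n" and K: "K \<subseteq> {..<n}"
  shows "det (submatrix M K K) = det (corner_mat n (\<lambda>i. of_bool (i \<in> K)) M)"
proof -
  let ?N = "M - 1\<^sub>m n"
  have N: "?N \<in> carrier_mat n n" by (simp add: minus_carrier_mat)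
  have "1\<^sub>m (card K) + submatrix ?N K K = submatrix M K K"
    by (rule submatrix_eqI[OF M K K, symmetric])
      (use M carrier_matD[OF submatrix_carrier[OF N K K]] in
        \<open>auto simp: index_submatrix[OF N K K] pick_less[OF K] pick_eq_iff\<close>)
  then show ?thesis
    using det_one_plus_mat_diag_of_bool_mult[OF N K] by (simp add: corner_mat_def)
qed

lemma det_eq_power_mult_det_corner_mat:
  fixes M :: "'a::comm_ring_1 mat"
  assumes M: "M \<in> carrier_mat n n" and K: "K \<subseteq> {..<n}"
    and outside: "\<And>i j. i < n \<Longrightarrow> j < n \<Longrightarrow> j \<notin> K \<Longrightarrow> M $$ (i, j) = (if i = j then c else 0)"
  shows "det M = c ^ card ({..<n} - K) * det (corner_mat n (\<lambda>i. of_bool (i \<in> K)) M)"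
proof -
  let ?N = "1\<^sub>m n + (M - 1\<^sub>m n) * mat_diag n (\<lambda>i. of_bool (i \<in> K))"
  let ?scaling = "mat_diag n (\<lambda>j. if j \<in> K then 1 else c)"
  have M1: "M - 1\<^sub>m n \<in> carrier_mat n n" by (simp add: minus_carrier_mat)
  then have N: "?N \<in> carrier_mat n n" by auto
  have "M = ?N * ?scaling"
    unfolding mat_diag_mult_right[OF N]
    using M outside by (intro eq_matI) (auto simp: mat_diag_mult_right[OF M1])
  then have "det M = det ?N * det ?scaling"
    using det_mult[OF N mat_diag_dim, of "\<lambda>j. if j \<in> K then 1 else c"] by simp
  also have "det ?N = det (corner_mat n (\<lambda>i. of_bool (i \<in> K)) M)"
    unfolding corner_mat_def by (rule det_one_plus_mult_commute[OF M1 mat_diag_dim])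
  also have "det ?scaling = (\<Prod>i\<in>{..<n} - K. c)"
    unfolding det_mat_diag by (rule prod.mono_neutral_cong_right) auto
  finally show ?thesis by (simp add: mult.commute)
qed

section \<open>The matrix \<open>I - Pu + (Q - I)u\<^sup>2\<close>\<close>

definition ihara_mat :: "nat \<Rightarrow> 'r::comm_ring_1 mat \<Rightarrow> 'r mat \<Rightarrow> 'r poly mat" where
  "ihara_mat n P Q = 1\<^sub>m n - [:0, 1:] \<cdot>\<^sub>m map_mat (\<lambda>x. [:x:]) P
     + [:0, 1:]\<^sup>2 \<cdot>\<^sub>m map_mat (\<lambda>x. [:x:]) (Q - 1\<^sub>m n)"

lemma ihara_det_conv_ihara_mat: "ihara_det n A C D = det (ihara_mat n (A * C) (D * C))"
  by (simp add: ihara_det_def ihara_mat_def)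

lemma ihara_mat_carrier [simp]: "ihara_mat n P Q \<in> carrier_mat n n"
  by (simp add: ihara_mat_def minus_carrier_mat)

lemma dim_ihara_mat [simp]: "dim_row (ihara_mat n P Q) = n" "dim_col (ihara_mat n P Q) = n"
  by (simp_all add: ihara_mat_def)

lemma index_ihara_mat:
  assumes "P \<in> carrier_mat n n" "Q \<in> carrier_mat n n" "i < n" "j < n"
  shows "ihara_mat n P Q $$ (i, j) =
    [:if i = j then 1 else 0, - P $$ (i, j), Q $$ (i, j) - (if i = j then 1 else 0):]"
  using assms by (simp add: ihara_mat_def power2_eq_square one_pCons)

lemma (in comm_ring_hom) map_ihara_mat:
  assumes "P \<in> carrier_mat n n" "Q \<in> carrier_mat n n"
  shows "map_mat (map_poly hom) (ihara_mat n P Q) = ihara_mat n (mat\<^sub>h P) (mat\<^sub>h Q)"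
proof (rule eq_matI)
  fix i j
  assume "i < dim_row (ihara_mat n (mat\<^sub>h P) (mat\<^sub>h Q))" "j < dim_col (ihara_mat n (mat\<^sub>h P) (mat\<^sub>h Q))"
  then show "map_mat (map_poly hom) (ihara_mat n P Q) $$ (i, j)
      = ihara_mat n (mat\<^sub>h P) (mat\<^sub>h Q) $$ (i, j)"
    using assms by (simp add: index_ihara_mat map_poly_pCons hom_distribs)
qed simp_all

lemma submatrix_ihara_mat:
  assumes P: "P \<in> carrier_mat n n" and Q: "Q \<in> carrier_mat n n" and K: "K \<subseteq> {..<n}"
  shows "submatrix (ihara_mat n P Q) K K = ihara_mat (card K) (submatrix P K K) (submatrix Q K K)"
  by (rule submatrix_eqI[OF ihara_mat_carrier K K])
    (simp_all add: index_submatrix[OF P K K] index_submatrix[OF Q K K] index_ihara_mat[OF P Q]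
      index_ihara_mat[OF submatrix_carrier[OF P K K] submatrix_carrier[OF Q K K]]
      pick_less[OF K] pick_eq_iff)

section \<open>Matrices of linear maps with respect to finite lists\<close>

definition lincomb :: "('r \<Rightarrow> 'm \<Rightarrow> 'm::comm_monoid_add) \<Rightarrow> (nat \<Rightarrow> 'r) \<Rightarrow> 'm list \<Rightarrow> 'm" where
  "lincomb s c xs = (\<Sum>i<length xs. s (c i) (xs ! i))"

definition represents ::
  "('r \<Rightarrow> 'm::comm_monoid_add \<Rightarrow> 'm) \<Rightarrow> 'm list \<Rightarrow> 'm list \<Rightarrow> ('m \<Rightarrow> 'm) \<Rightarrow> 'r mat \<Rightarrow> bool" where
  "represents s xs ys f A \<longleftrightarrow> A \<in> carrier_mat (length ys) (length xs) \<and>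
     (\<forall>j<length xs. f (xs ! j) = lincomb s (\<lambda>i. A $$ (i, j)) ys)"

lemma lincomb_cong:
  assumes "\<And>i. i < length xs \<Longrightarrow> s (c i) (xs ! i) = s (d i) (xs ! i)"
  shows "lincomb s c xs = lincomb s d xs"
  unfolding lincomb_def using assms by (intro sum.cong) auto

context Modules.module
begin

lemma lincomb_add: "lincomb scale (\<lambda>i. c i + d i) xs = lincomb scale c xs + lincomb scale d xs"
  by (simp add: lincomb_def scale_left_distrib sum.distrib)

lemma lincomb_diff: "lincomb scale (\<lambda>i. c i - d i) xs = lincomb scale c xs - lincomb scale d xs"
  by (simp add: lincomb_def scale_left_diff_distrib sum_subtractf)

lemma lincomb_uminus: "lincomb scale (\<lambda>i. - c i) xs = - lincomb scale c xs"
  by (simp add: lincomb_def sum_negf)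

lemma lincomb_scale: "lincomb scale (\<lambda>i. a * c i) xs = a *s lincomb scale c xs"
  by (simp add: lincomb_def scale_sum_right)

lemma lincomb_unit:
  assumes "j < length xs"
  shows "lincomb scale (\<lambda>i. if i = j then a else 0) xs = a *s (xs ! j)"
proof -
  have "lincomb scale (\<lambda>i. if i = j then a else 0) xs
      = (\<Sum>i<length xs. if i = j then a *s (xs ! j) else 0)"
    unfolding lincomb_def by (rule sum.cong) auto
  then show ?thesis using assms by simp
qed

lemma span_set: "span (set xs) = range (\<lambda>c. lincomb scale c xs)"
proof
  show "range (\<lambda>c. lincomb scale c xs) \<subseteq> span (set xs)"
    unfolding lincomb_def by (intro image_subsetI span_sum span_scale span_base) simp
  show "span (set xs) \<subseteq> range (\<lambda>c. lincomb scale c xs)"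
  proof (rule span_minimal)
    show "set xs \<subseteq> range (\<lambda>c. lincomb scale c xs)"
    proof
      fix x assume "x \<in> set xs"
      then obtain j where "j < length xs" "x = xs ! j" by (auto simp: in_set_conv_nth)
      then have "x = lincomb scale (\<lambda>i. if i = j then 1 else 0) xs"
        by (simp add: lincomb_unit)
      then show "x \<in> range (\<lambda>c. lincomb scale c xs)" by blast
    qed
    show "subspace (range (\<lambda>c. lincomb scale c xs))"
    proof (rule subspaceI)
      have "lincomb scale (\<lambda>_. 0) xs = 0" by (simp add: lincomb_def)
      then show "0 \<in> range (\<lambda>c. lincomb scale c xs)" by (metis rangeI)
    qed (auto simp flip: lincomb_add lincomb_scale)
  qed
qed

lemma sum_set_conv_lincomb:
  assumes "distinct xs"
  shows "(\<Sum>x\<in>set xs. c x *s x) = lincomb scale (\<lambda>i. c (xs ! i)) xs"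
  unfolding lincomb_def using bij_betw_nth[OF assms refl refl]
  by (simp add: sum.reindex_bij_betw[symmetric])

lemma independent_lincombD:
  assumes "distinct xs" "independent (set xs)" "lincomb scale c xs = 0" "i < length xs"
  shows "c i = 0"
proof -
  define d where "d x = c (the_inv_into {..<length xs} ((!) xs) x)" for x
  have d_nth: "d (xs ! k) = c k" if "k < length xs" for k
    using that assms(1) by (simp add: d_def the_inv_into_f_f inj_on_nth)
  have "(\<Sum>x\<in>set xs. d x *s x) = lincomb scale c xs"
    unfolding sum_set_conv_lincomb[OF assms(1)] by (rule lincomb_cong) (simp add: d_nth)
  then have "d (xs ! i) = 0"
    using independentD[OF assms(2) finite_set subset_refl] assms(3,4) by simp
  then show ?thesis using d_nth assms(4) by simp
qed

lemma independent_lincombI: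
  assumes "\<And>c i. lincomb scale c xs = 0 \<Longrightarrow> i < length xs \<Longrightarrow> c i = 0"
  shows "distinct xs" "independent (set xs)"
proof -
  show distinct: "distinct xs"
    unfolding distinct_conv_nth
  proof (intro allI impI notI)
    fix i j assume ij: "i < length xs" "j < length xs" "i \<noteq> j" "xs ! i = xs ! j"
    let ?c = "\<lambda>k. (if k = i then 1 else 0) - (if k = j then 1 else (0::'a))"
    have "lincomb scale ?c xs = 0"
      unfolding lincomb_diff using ij by (simp add: lincomb_unit)
    then have "?c i = 0" using assms[of ?c i] ij(1) by blast
    then show False using ij(3) by simp
  qed
  show "independent (set xs)"
    unfolding dependent_finite[OF finite_set] sum_set_conv_lincomb[OF distinct]
    using assms[of "\<lambda>i. _ (xs ! i)"] by (auto simp: in_set_conv_nth)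
qed

lemma represents_unique:
  assumes "represents scale xs ys f A" "represents scale xs ys f B"
    and "distinct ys" "independent (set ys)"
  shows "A = B"
proof (rule eq_matI)
  fix i j assume "i < dim_row B" "j < dim_col B"
  then have ij: "i < length ys" "j < length xs"
    using assms(2) by (auto simp: represents_def)
  have "lincomb scale (\<lambda>i. A $$ (i, j) - B $$ (i, j)) ys = 0"
    using assms(1,2) ij by (simp add: represents_def lincomb_diff)
  from independent_lincombD[OF assms(3,4) this ij(1)] show "A $$ (i, j) = B $$ (i, j)" by simp
qed (use assms in \<open>auto simp: represents_def\<close>)

lemma represents_exists:
  assumes "\<And>x. x \<in> set xs \<Longrightarrow> f x \<in> span (set ys)"
  obtains A where "represents scale xs ys f A"
proof -
  have "\<exists>c. f x = lincomb scale c ys" if "x \<in> set xs" for x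
    using assms[OF that] unfolding span_set by blast
  then obtain c where "f x = lincomb scale (c x) ys" if "x \<in> set xs" for x
    by metis
  then have "represents scale xs ys f (mat (length ys) (length xs) (\<lambda>(i, j). c (xs ! j) i))"
    unfolding represents_def by (auto intro!: lincomb_cong)
  then show thesis by (rule that)
qed

lemma represents_comp:
  assumes "module_hom scale scale f" "represents scale xs ys h A" "represents scale ys zs f B"
  shows "represents scale xs zs (\<lambda>x. f (h x)) (B * A)"
proof -
  interpret f: module_hom scale scale f by fact
  have A: "A \<in> carrier_mat (length ys) (length xs)" and B: "B \<in> carrier_mat (length zs) (length ys)"
    using assms by (auto simp: represents_def)
  have "f (h (xs ! j)) = lincomb scale (\<lambda>i. (B * A) $$ (i, j)) zs" if j: "j < length xs" for j
  proof -
    have "f (h (xs ! j)) = (\<Sum>k<length ys. A $$ (k, j) *s (\<Sum>i<length zs. B $$ (i, k) *s (zs ! i)))"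
      using assms j by (simp add: represents_def lincomb_def f.sum f.scale)
    also have "\<dots> = (\<Sum>i<length zs. \<Sum>k<length ys. (B $$ (i, k) * A $$ (k, j)) *s (zs ! i))"
      by (subst sum.swap) (simp add: scale_sum_right mult.commute)
    also have "\<dots> = lincomb scale (\<lambda>i. (B * A) $$ (i, j)) zs"
      unfolding lincomb_def using A B j
      by (intro sum.cong refl) (simp add: scalar_prod_def scale_sum_left atLeast0LessThan)
    finally show ?thesis .
  qed
  then show ?thesis using A B by (simp add: represents_def)
qed

lemma represents_diff_id:
  assumes "represents scale xs xs f A"
  shows "represents scale xs xs (\<lambda>x. f x - x) (A - 1\<^sub>m (length xs))"
proof -
  have "f (xs ! j) - xs ! j = lincomb scale (\<lambda>i. (A - 1\<^sub>m (length xs)) $$ (i, j)) xs"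
    if "j < length xs" for j
  proof -
    have "lincomb scale (\<lambda>i. (A - 1\<^sub>m (length xs)) $$ (i, j)) xs
        = lincomb scale (\<lambda>i. A $$ (i, j) - (if i = j then 1 else 0)) xs"
      by (rule lincomb_cong) (use that assms in \<open>auto simp: represents_def\<close>)
    then show ?thesis
      using that assms by (simp add: represents_def lincomb_diff lincomb_unit)
  qed
  then show ?thesis by (simp add: represents_def minus_carrier_mat)
qed

text \<open>
  If \<open>R\<close> and \<open>Q\<close> are the matrices of \<open>f - id\<close> and \<open>\<pi>\<close> from one basis to the other, then those of
  \<open>f - id = \<pi> \<circ> (f - id) = (f - id) \<circ> \<pi>\<close> for the two bases are \<open>Q R\<close> and \<open>R Q\<close>.
\<close>

lemma det_represents_eq:
  assumes hom_\<pi>: "module_hom scale scale \<pi>" and hom_diff: "module_hom scale scale (\<lambda>x. f x - x)"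
    and absorb_left: "\<And>x. \<pi> (f x - x) = f x - x" and absorb_right: "\<And>x. f (\<pi> x) - \<pi> x = f x - x"
    and xs: "distinct xs" "independent (set xs)" and A: "represents scale xs xs f A"
    and ys: "distinct ys" "independent (set ys)" and B: "represents scale ys ys f B"
    and into_ys: "\<And>x. x \<in> set xs \<Longrightarrow> f x - x \<in> span (set ys)"
    and into_xs: "\<And>y. y \<in> set ys \<Longrightarrow> \<pi> y \<in> span (set xs)"
  shows "det A = det B"
proof -
  define n where "n = length xs"
  define m where "m = length ys"
  obtain R where R: "represents scale xs ys (\<lambda>x. f x - x) R"
    using represents_exists[of xs "\<lambda>x. f x - x" ys] into_ys by blast
  obtain Q where Q: "represents scale ys xs \<pi> Q"
    using represents_exists[of ys \<pi> xs] into_xs by blast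
  have A_minus_one: "A - 1\<^sub>m n = Q * R"
    using represents_unique[OF represents_diff_id[OF A] _ xs] represents_comp[OF hom_\<pi> R Q]
    by (simp add: absorb_left n_def)
  have B_minus_one: "B - 1\<^sub>m m = R * Q"
    using represents_unique[OF represents_diff_id[OF B] _ ys] represents_comp[OF hom_diff Q R]
    by (simp add: absorb_right m_def)
  have carrier: "A \<in> carrier_mat n n" "B \<in> carrier_mat m m" "R \<in> carrier_mat m n" "Q \<in> carrier_mat n m"
    using A B R Q by (auto simp: represents_def n_def m_def)
  have "det A = det (1\<^sub>m n + Q * R)"
    unfolding A_minus_one[symmetric] using carrier by (intro arg_cong[of _ _ det] eq_matI) auto
  also have "\<dots> = det (1\<^sub>m m + R * Q)"
    by (rule det_one_plus_mult_commute[OF carrier(4,3)])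
  also have "\<dots> = det B"
    unfolding B_minus_one[symmetric] using carrier by (intro arg_cong[of _ _ det] eq_matI) auto
  finally show ?thesis .
qed

lemma represents_corner_mat_fixed:
  assumes "\<And>i. i < length xs \<Longrightarrow> E i *s (xs ! i) = xs ! i" and A: "represents scale xs xs f A"
  shows "represents scale xs xs f (corner_mat (length xs) E A)"
    (is "represents _ _ _ _ ?B")
proof -
  have "?B $$ (i, j) *s (xs ! i) = A $$ (i, j) *s (xs ! i)" if "i < length xs" "j < length xs" for i j
    using assms(1)[OF that(1)] A that
    by (simp add: represents_def index_corner_mat scale_left_distrib scale_left_diff_distrib
        mult.commute[of "E i"] flip: scale_scale)
  then show ?thesis
    using A by (auto simp: represents_def intro!: lincomb_cong)
qed

lemma represents_corner_mat_annihilated: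
  assumes "\<And>i. i < length ys \<Longrightarrow> E i *s (ys ! i) = 0" and A: "A \<in> carrier_mat (length ys) (length ys)"
  shows "represents scale ys ys id (corner_mat (length ys) E A)"
    (is "represents _ _ _ _ ?B")
proof -
  have "?B $$ (i, j) *s (ys ! i) = (if i = j then 1 else 0) *s (ys ! i)"
    if "i < length ys" "j < length ys" for i j
    using assms(1)[OF that(1)] A that
    by (simp add: index_corner_mat scale_left_distrib mult.commute[of "E i"] flip: scale_scale)
  then have "lincomb scale (\<lambda>i. ?B $$ (i, j)) ys = 1 *s (ys ! j)" if "j < length ys" for j
    unfolding lincomb_unit[OF that, symmetric] using that by (intro lincomb_cong) auto
  then show ?thesis by (simp add: represents_def)
qed

end

context module_prod
begin

lemma lincomb_zip:
  assumes "length xs = length ys"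
  shows "lincomb scale c (zip xs ys) = (lincomb s1 c xs, lincomb s2 c ys)"
  using assms by (simp add: lincomb_def prod_eq_iff fst_sum snd_sum scale_def)

lemma represents_map_prod:
  assumes "represents s1 xs xs f A" "represents s2 ys ys h A" "length xs = length ys"
  shows "represents scale (zip xs ys) (zip xs ys) (map_prod f h) A"
  using assms by (simp add: represents_def lincomb_zip)

lemma independent_zip:
  assumes len: "length xs = length ys"
    and ann_xs: "\<And>c i. lincomb s1 c xs = 0 \<Longrightarrow> i < length xs \<Longrightarrow> c i * E i = 0"
    and ann_ys: "\<And>c i. lincomb s2 c ys = 0 \<Longrightarrow> i < length ys \<Longrightarrow> c i * (1 - E i) = 0"
  shows "distinct (zip xs ys)" "p.independent (set (zip xs ys))"
proof -
  have coeff_zero: "c i = 0" if "lincomb scale c (zip xs ys) = 0" "i < length (zip xs ys)" for c i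
  proof -
    have "c i * E i = 0" "c i * (1 - E i) = 0"
      using that len ann_xs[of c i] ann_ys[of c i] by (simp_all add: lincomb_zip zero_prod_def)
    then show ?thesis by (simp add: algebra_simps)
  qed
  show "distinct (zip xs ys)" "p.independent (set (zip xs ys))"
    by (rule p.independent_lincombI, use coeff_zero in blast)+
qed

lemma span_zip:
  assumes len: "length xs = length ys"
    and fixes_xs: "\<And>i. i < length xs \<Longrightarrow> s1 (E i) (xs ! i) = xs ! i"
    and kills_ys: "\<And>i. i < length ys \<Longrightarrow> s2 (E i) (ys ! i) = 0"
  shows "p.span (set (zip xs ys)) = m1.span (set xs) \<times> m2.span (set ys)"
proof
  show "p.span (set (zip xs ys)) \<subseteq> m1.span (set xs) \<times> m2.span (set ys)"
    unfolding p.span_set m1.span_set m2.span_set using len by (auto simp: lincomb_zip)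
  have "(lincomb s1 c xs, lincomb s2 d ys)
      = lincomb scale (\<lambda>i. c i * E i + d i * (1 - E i)) (zip xs ys)" for c d
  proof -
    have "lincomb s1 (\<lambda>i. c i * E i + d i * (1 - E i)) xs = lincomb s1 c xs"
      by (rule lincomb_cong)
        (simp add: m1.scale_left_distrib m1.scale_left_diff_distrib fixes_xs flip: m1.scale_scale)
    moreover have "lincomb s2 (\<lambda>i. c i * E i + d i * (1 - E i)) ys = lincomb s2 d ys"
      by (rule lincomb_cong)
        (simp add: m2.scale_left_distrib m2.scale_left_diff_distrib kills_ys flip: m2.scale_scale)
    ultimately show ?thesis using len by (simp add: lincomb_zip)
  qed
  then show "m1.span (set xs) \<times> m2.span (set ys) \<subseteq> p.span (set (zip xs ys))"
    unfolding p.span_set m1.span_set m2.span_set by auto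
qed

end

section \<open>Uniqueness of the determinant of an endomorphism\<close>

lemma is_endo_det_altdef:
  "is_endo_det s M N f d \<longleftrightarrow>
     (\<exists>bs B. distinct bs \<and> \<not> module.dependent (module_prod.scale s pm_scale) (set bs) \<and>
        module.span (module_prod.scale s pm_scale) (set bs) = M \<times> N \<and>
        represents (module_prod.scale s pm_scale) bs bs (map_prod f id) B \<and> d = det B)"
  unfolding is_endo_det_def represents_def lincomb_def Let_def by (simp add: conj_assoc)

lemma is_endo_det_unique:
  assumes s: "Modules.module s" and f: "module_hom s s f"
    and d: "is_endo_det s M N f d" and d': "is_endo_det s M N' f d'"
  shows "d = d'"
proof -
  interpret module_prod s pm_scale
    by (simp add: module_prod_def module_pair_def s module_pm_scale)
  interpret f: module_hom s s f by fact
  obtain bs B where bs: "distinct bs" "p.independent (set bs)" and span_bs: "p.span (set bs) = M \<times> N"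
    and B: "represents scale bs bs (map_prod f id) B" "d = det B"
    using d unfolding is_endo_det_altdef by blast
  obtain cs C where cs: "distinct cs" "p.independent (set cs)" and span_cs: "p.span (set cs) = M \<times> N'"
    and C: "represents scale cs cs (map_prod f id) C" "d' = det C"
    using d' unfolding is_endo_det_altdef by blast
  let ?\<pi> = "\<lambda>x. (fst x, 0)"
  have "det B = det C"
  proof (rule p.det_represents_eq[where \<pi> = ?\<pi> and f = "map_prod f id", OF _ _ _ _ bs B(1) cs C(1)])
    show "module_hom scale scale ?\<pi>"
      by unfold_locales (auto simp: scale_def)
    show "module_hom scale scale (\<lambda>x. map_prod f id x - x)"
      by unfold_locales
        (auto simp: scale_def f.add f.scale m1.scale_right_diff_distrib map_prod_def split_beta)
    have zero: "0 \<in> N" "0 \<in> N'"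
      using p.span_zero[of "set bs"] p.span_zero[of "set cs"]
      unfolding span_bs span_cs by (simp_all add: zero_prod_def)
    show "?\<pi> x \<in> p.span (set bs)" if "x \<in> set cs" for x
      using p.span_base[OF that] zero unfolding span_bs span_cs by auto
    show "map_prod f id x - x \<in> p.span (set cs)" if x: "x \<in> set bs" for x
    proof -
      have "x \<in> M \<times> N" using p.span_base[OF x] unfolding span_bs .
      moreover have "map_prod f id x \<in> p.span (set bs)"
        using B(1) x unfolding represents_def p.span_set by (auto simp: in_set_conv_nth)
      ultimately have "map_prod f id x - x \<in> p.span (set bs)"
        using p.span_diff span_bs by blast
      then show ?thesis
        using zero unfolding span_bs span_cs by (cases x) auto
    qed
  qed (auto simp: map_prod_def split_beta)
  then show ?thesis by (simp add: B(2) C(2))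
qed

lemma endo_det_eqI:
  assumes "Modules.module s" "module_hom s s f"
    and "module.subspace pm_scale N" "is_endo_det s M N f d"
  shows "endo_det s M f = d"
  unfolding endo_det_def
  by (rule the_equality) (use assms is_endo_det_unique in blast)+

lemma idempotent_if_annihilator:
  assumes s: "Modules.module s"
    and E: "s (E i) (xs ! i) = xs ! i" and i: "i < length xs"
    and ann: "\<And>c. lincomb s c xs = 0 \<Longrightarrow> c i * E i = 0"
  shows "E i * E i = E i"
proof -
  interpret Modules.module s by fact
  have "lincomb s (\<lambda>k. if k = i then 1 - E i else 0) xs = 0"
    using i E by (simp add: lincomb_unit scale_left_diff_distrib)
  then have "(1 - E i) * E i = 0" using ann[of "\<lambda>k. if k = i then 1 - E i else 0"] by simp
  then show ?thesis by (simp add: algebra_simps)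
qed

lemma pm_scale_single: "pm_scale c (Poly_Mapping.single k d) = Poly_Mapping.single k (c * d)"
  by (rule poly_mapping_eqI) (simp add: lookup_single when_def)

definition complementary_generators :: "nat \<Rightarrow> (nat \<Rightarrow> 'r::comm_ring_1) \<Rightarrow> (nat \<Rightarrow>\<^sub>0 'r) list" where
  "complementary_generators n E = map (\<lambda>i. Poly_Mapping.single i (1 - E i)) [0..<n]"

lemma length_complementary_generators [simp]: "length (complementary_generators n E) = n"
  by (simp add: complementary_generators_def)

lemma pm_scale_complementary_generators:
  assumes "i < n" "E i * E i = E i"
  shows "pm_scale (E i) (complementary_generators n E ! i) = 0"
proof -
  have "E i * (1 - E i) = 0" using assms(2) by (simp add: right_diff_distrib)
  then show ?thesis using assms(1) by (simp add: complementary_generators_def pm_scale_single)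
qed

lemma lookup_lincomb_complementary_generators:
  assumes "i < n"
  shows "Poly_Mapping.lookup (lincomb pm_scale c (complementary_generators n E)) i = c i * (1 - E i)"
proof -
  have "Poly_Mapping.lookup (lincomb pm_scale c (complementary_generators n E)) i
      = (\<Sum>k<n. if k = i then c i * (1 - E i) else 0)"
    unfolding lincomb_def lookup_sum
    by (rule sum.cong) (auto simp: complementary_generators_def lookup_single when_def)
  then show ?thesis using assms by simp
qed

text \<open>
  The \<open>i\<close>-th generator spans a copy of the ideal generated by the idempotent \<open>E i\<close>, which the
  complementary generator completes to a free module of rank one.
\<close>

lemma endo_det_idempotent_generators:
  fixes s :: "'r::comm_ring_1 \<Rightarrow> 'm::ab_group_add \<Rightarrow> 'm"
  assumes s: "Modules.module s" and f: "module_hom s s f"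
    and E: "\<And>i. i < length xs \<Longrightarrow> s (E i) (xs ! i) = xs ! i"
    and ann: "\<And>c i. lincomb s c xs = 0 \<Longrightarrow> i < length xs \<Longrightarrow> c i * E i = 0"
    and A: "represents s xs xs f A"
  shows "endo_det s (module.span s (set xs)) f = det (corner_mat (length xs) E A)"
proof -
  interpret module_prod s pm_scale
    by (simp add: module_prod_def module_pair_def s module_pm_scale)
  let ?n = "length xs"
  let ?ys = "complementary_generators ?n E"
  let ?B = "corner_mat ?n E A"
  have annihilated: "pm_scale (E i) (?ys ! i) = 0" if "i < ?n" for i
  proof (rule pm_scale_complementary_generators[OF that])
    show "E i * E i = E i"
      by (rule idempotent_if_annihilator[OF s, where xs = xs]) (use that E ann in auto)
  qed
  have ann_ys: "c i * (1 - E i) = 0" if "lincomb pm_scale c ?ys = 0" "i < length ?ys" for c i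
    using that lookup_lincomb_complementary_generators[of i ?n c E] by simp
  have "represents s xs xs f ?B"
    using E A by (rule m1.represents_corner_mat_fixed)
  moreover have "represents pm_scale ?ys ?ys id ?B"
    using m2.represents_corner_mat_annihilated[of ?ys E A] annihilated A by (simp add: represents_def)
  ultimately have "represents scale (zip xs ?ys) (zip xs ?ys) (map_prod f id) ?B"
    by (intro represents_map_prod) simp_all
  moreover have "p.span (set (zip xs ?ys)) = m1.span (set xs) \<times> m2.span (set ?ys)"
    by (rule span_zip[of _ _ E]) (simp_all add: E annihilated)
  moreover have "distinct (zip xs ?ys)" "p.independent (set (zip xs ?ys))"
    by (rule independent_zip[of _ _ E]; use ann ann_ys in simp)+
  ultimately have "is_endo_det s (m1.span (set xs)) (m2.span (set ?ys)) f (det ?B)"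
    unfolding is_endo_det_altdef by blast
  then show ?thesis
    by (intro endo_det_eqI[OF s f]) simp_all
qed

section \<open>Group rings and characters\<close>

lemma sum_single_lookup:
  "(\<Sum>k\<in>Poly_Mapping.keys x. Poly_Mapping.single k (Poly_Mapping.lookup x k)) = x"
  by (rule poly_mapping_eqI) (auto simp: lookup_sum lookup_single when_def in_keys_iff)

lemma comm_ring_hom_map_poly_mapping:
  assumes "comm_ring_hom h"
  shows "comm_ring_hom
    (Poly_Mapping.map h :: ('g::comm_monoid_add \<Rightarrow>\<^sub>0 'a::comm_ring_1) \<Rightarrow> ('g \<Rightarrow>\<^sub>0 'b::comm_ring_1))"
proof -
  interpret h: comm_ring_hom h by fact
  have lookup: "Poly_Mapping.lookup (Poly_Mapping.map h x) k = h (Poly_Mapping.lookup x k)"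
    for x :: "'g \<Rightarrow>\<^sub>0 'a" and k
    by (simp add: Poly_Mapping.map.rep_eq when_def)
  have add: "Poly_Mapping.map h (x + y) = Poly_Mapping.map h x + Poly_Mapping.map h y"
    for x y :: "'g \<Rightarrow>\<^sub>0 'a"
    by (rule poly_mapping_eqI) (simp add: lookup lookup_add h.hom_add)
  have single: "Poly_Mapping.map h (Poly_Mapping.single k c) = Poly_Mapping.single k (h c)"
    for k :: 'g and c
    by (rule map_single) simp
  show ?thesis
  proof
    show "Poly_Mapping.map h (x + y) = Poly_Mapping.map h x + Poly_Mapping.map h y"
      for x y :: "'g \<Rightarrow>\<^sub>0 'a"
      by (rule add)
    show "Poly_Mapping.map h (0 :: 'g \<Rightarrow>\<^sub>0 'a) = 0"
      using single[of 0 0] by simp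
    show "Poly_Mapping.map h (1 :: 'g \<Rightarrow>\<^sub>0 'a) = 1"
      using single[of 0 1] by simp
    show "Poly_Mapping.map h (x * y) = Poly_Mapping.map h x * Poly_Mapping.map h y"
      for x y :: "'g \<Rightarrow>\<^sub>0 'a"
    proof (induction x rule: poly_mapping_single_induct)
      case (single k c)
      show ?case
        by (induction y rule: poly_mapping_single_induct)
          (simp_all add: mult_single single distrib_left add h.hom_mult)
    qed (simp add: distrib_right add)
  qed
qed

lemma char_ext_single [simp]: "char_ext \<psi> (Poly_Mapping.single a c) = c * \<psi> a"
  by (simp add: char_ext_def)

lemma char_ext_int_single [simp]: "char_ext_int \<psi> (Poly_Mapping.single a c) = of_int c * \<psi> a"
  by (simp add: char_ext_int_def)

lemma char_ext_add: "char_ext \<psi> (x + y) = char_ext \<psi> x + char_ext \<psi> y"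
  unfolding char_ext_def by (rule setsum_keys_plus_distrib) (simp_all add: distrib_right)

lemma is_character_0:
  assumes "is_character \<psi>"
  shows "\<psi> 0 = 1"
  using assms by (metis add_0 is_character_def mult_cancel_left2)

lemma comm_ring_hom_char_ext:
  assumes \<psi>: "is_character \<psi>"
  shows "comm_ring_hom (char_ext \<psi>)"
proof
  show "char_ext \<psi> (x + y) = char_ext \<psi> x + char_ext \<psi> y" for x y
    by (rule char_ext_add)
  show "char_ext \<psi> 0 = 0" by (simp add: char_ext_def)
  show "char_ext \<psi> 1 = 1"
    using char_ext_single[of \<psi> 0 1] is_character_0[OF \<psi>] by simp
  show "char_ext \<psi> (x * y) = char_ext \<psi> x * char_ext \<psi> y" for x y
  proof (induction x rule: poly_mapping_single_induct)
    case (single a c)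
    show ?case
      by (induction y rule: poly_mapping_single_induct)
        (use \<psi> in \<open>simp_all add: mult_single distrib_left char_ext_add is_character_def\<close>)
  qed (simp add: distrib_right char_ext_add)
qed

lemma comm_ring_hom_char_ext_int:
  assumes "is_character \<psi>"
  shows "comm_ring_hom (char_ext_int \<psi>)"
proof -
  interpret \<psi>: comm_ring_hom "char_ext \<psi>" by (rule comm_ring_hom_char_ext[OF assms])
  interpret \<iota>: comm_ring_hom "Poly_Mapping.map of_int :: _ \<Rightarrow> 'a \<Rightarrow>\<^sub>0 complex"
    by (rule comm_ring_hom_map_poly_mapping) unfold_locales
  show ?thesis
    by unfold_locales (simp_all add: char_ext_int_def \<iota>.hom_add \<iota>.hom_mult \<psi>.hom_add \<psi>.hom_mult)
qed

lemma sum_character_subgroup: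
  assumes \<psi>: "is_character \<psi>" and S: "is_subgroup S"
  shows "(\<Sum>a\<in>S. \<psi> a) = (if S \<subseteq> char_ker \<psi> then of_nat (card S) else 0)"
proof (cases "S \<subseteq> char_ker \<psi>")
  case True
  then have "(\<Sum>a\<in>S. \<psi> a) = (\<Sum>a\<in>S. 1)"
    by (intro sum.cong) (auto simp: char_ker_def)
  then show ?thesis using True by simp
next
  case False
  then obtain b where b: "b \<in> S" "\<psi> b \<noteq> 1" by (auto simp: char_ker_def)
  have "b + (a - b) = a" "a - b \<in> S" "b + a \<in> S" if "a \<in> S" for a
    using S b that unfolding is_subgroup_def
    by (auto simp: diff_conv_add_uminus simp del: add_uminus_conv_diff)
  then have "(\<Sum>a\<in>S. \<psi> a) = (\<Sum>a\<in>S. \<psi> (b + a))"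
    by (intro sum.reindex_bij_witness[of _ "\<lambda>a. b + a" "\<lambda>a. a - b"]) auto
  also have "\<dots> = \<psi> b * (\<Sum>a\<in>S. \<psi> a)"
    using \<psi> by (simp add: is_character_def sum_distrib_left)
  finally have "(\<Sum>a\<in>S. \<psi> a) = 0" using b(2) by simp
  then show ?thesis using False by simp
qed

section \<open>Averages over subgroups\<close>

definition average :: "'g set \<Rightarrow> ('g \<Rightarrow>\<^sub>0 complex)" where
  "average S = (\<Sum>a\<in>S. Poly_Mapping.single a (1 / of_nat (card S)))"

lemma is_subgroup_card_pos:
  assumes "is_subgroup S" "finite S"
  shows "card S > 0"
  using assms by (auto simp: is_subgroup_def card_gt_0_iff)

lemma char_ext_average:
  assumes \<psi>: "is_character \<psi>" and S: "is_subgroup S" "finite S"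
  shows "char_ext \<psi> (average S) = of_bool (S \<subseteq> char_ker \<psi>)"
proof -
  interpret \<psi>: comm_ring_hom "char_ext \<psi>" by (rule comm_ring_hom_char_ext[OF \<psi>])
  have "char_ext \<psi> (average S) = (\<Sum>a\<in>S. \<psi> a) / of_nat (card S)"
    by (simp add: average_def \<psi>.hom_sum sum_divide_distrib)
  then show ?thesis
    using is_subgroup_card_pos[OF S] by (simp add: sum_character_subgroup[OF \<psi> S(1)] card_gt_0_iff)
qed

lemma coset_cancel: "coset \<tau> S = coset \<tau> T \<longleftrightarrow> S = T"
  unfolding coset_def by (simp add: inj_image_eq_iff)

lemma coset_eq_self_iff:
  assumes "is_subgroup S"
  shows "coset \<tau> S = S \<longleftrightarrow> \<tau> \<in> S"
proof
  assume "coset \<tau> S = S"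
  moreover have "\<tau> + 0 \<in> coset \<tau> S"
    using assms unfolding coset_def is_subgroup_def by blast
  ultimately show "\<tau> \<in> S" by simp
next
  assume \<tau>: "\<tau> \<in> S"
  have "b \<in> coset \<tau> S" if "b \<in> S" for b
  proof -
    have "- \<tau> + b \<in> S" using assms \<tau> that unfolding is_subgroup_def by blast
    then have "\<tau> + (- \<tau> + b) \<in> coset \<tau> S" unfolding coset_def by blast
    then show ?thesis by simp
  qed
  moreover have "\<tau> + b \<in> S" if "b \<in> S" for b
    using assms \<tau> that unfolding is_subgroup_def by blast
  ultimately show "coset \<tau> S = S" by (auto simp: coset_def)
qed

lemma coset_eq_iff:
  assumes "is_subgroup S"
  shows "coset \<tau> S = coset \<sigma> S \<longleftrightarrow> \<sigma> - \<tau> \<in> S"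
proof -
  have "coset \<sigma> S = coset \<tau> (coset (\<sigma> - \<tau>) S)" by (simp add: coset_coset)
  then have "coset \<tau> S = coset \<sigma> S \<longleftrightarrow> coset (\<sigma> - \<tau>) S = S" by (auto simp: coset_cancel)
  then show ?thesis by (simp add: coset_eq_self_iff[OF assms])
qed

abbreviation vertex_scale ::
  "('g::ab_group_add \<Rightarrow>\<^sub>0 complex) \<Rightarrow> ('v \<times> 'g set \<Rightarrow>\<^sub>0 complex) \<Rightarrow> ('v \<times> 'g set \<Rightarrow>\<^sub>0 complex)" where
  "vertex_scale \<equiv> group_ring_scale vertex_act"

lemma module_vertex_scale: "Modules.module vertex_scale"
  by (rule module_group_ring_scale[OF vertex_act_0 vertex_act_add])

lemma vertex_act_fixes:
  assumes "is_subgroup S" "\<tau> \<in> S"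
  shows "vertex_act \<tau> (w, S) = (w, S)"
  using coset_eq_self_iff[OF assms(1)] assms(2) by (simp add: vertex_act_def)

lemma vertex_scale_average:
  assumes "is_subgroup S" "finite S"
  shows "vertex_scale (average S) (Poly_Mapping.single (w, S) c) = Poly_Mapping.single (w, S) c"
proof -
  interpret Modules.module vertex_scale by (rule module_vertex_scale)
  have "vertex_scale (average S) (Poly_Mapping.single (w, S) c)
      = (\<Sum>a\<in>S. Poly_Mapping.single (w, S) (c / of_nat (card S)))"
    unfolding average_def scale_sum_left
    by (rule sum.cong) (simp_all add: group_ring_scale_single vertex_act_fixes[OF assms(1)])
  also have "\<dots> = Poly_Mapping.single (w, S) c"
    using is_subgroup_card_pos[OF assms]
    by (intro poly_mapping_eqI) (auto simp: lookup_sum lookup_single when_def)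
  finally show ?thesis .
qed

lemma lookup_mult_average:
  assumes "is_subgroup S" "finite S"
  shows "Poly_Mapping.lookup (a * average S) \<sigma> =
    Poly_Mapping.lookup (vertex_scale a (Poly_Mapping.single (w, S) 1)) (w, coset \<sigma> S)
      / of_nat (card S)"
proof (induction a rule: poly_mapping_single_induct)
  case (single \<tau> c)
  have "Poly_Mapping.lookup (Poly_Mapping.single \<tau> c * average S) \<sigma>
      = (\<Sum>b\<in>S. if b = \<sigma> - \<tau> then c / of_nat (card S) else 0)"
    unfolding average_def sum_distrib_left lookup_sum
    by (rule sum.cong) (auto simp: mult_single lookup_single when_def)
  also have "\<dots> = (if \<sigma> - \<tau> \<in> S then c / of_nat (card S) else 0)"
    using assms(2) by simp
  finally show ?case
    by (simp add: group_ring_scale_single vertex_act_def lookup_single when_def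
        coset_eq_iff[OF assms(1)])
qed (simp add: distrib_right group_ring_scale_add_left lookup_add add_divide_distrib)

lemma lookup_vertex_scale_other_fibre:
  assumes "w \<noteq> w'"
  shows "Poly_Mapping.lookup (vertex_scale a (Poly_Mapping.single (w, S) c)) (w', T) = 0"
  by (induction a rule: poly_mapping_single_induct)
    (use assms in \<open>simp_all add: group_ring_scale_single group_ring_scale_add_left vertex_act_def
      lookup_single lookup_add when_def\<close>)

section \<open>Polynomial extension of scalars\<close>

lemma coeff_poly_scale_const:
  assumes "Modules.module s"
  shows "coeff (poly_scale s p [:x:]) n = s (coeff p n) x"
proof -
  interpret Modules.module s by fact
  have "coeff (poly_scale s p [:x:]) n = (\<Sum>i\<le>n. if i = n then s (coeff p n) x else 0)"
    unfolding coeff_poly_scale[OF assms]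
    by (rule sum.cong) (auto simp: coeff_pCons split: nat.splits)
  then show ?thesis by simp
qed

abbreviation const_polys :: "'m::zero list \<Rightarrow> 'm poly list" where
  "const_polys xs \<equiv> map (\<lambda>x. [:x:]) xs"

lemma coeff_lincomb_poly_scale:
  assumes "Modules.module s"
  shows "coeff (lincomb (poly_scale s) c (const_polys xs)) n = lincomb s (\<lambda>i. coeff (c i) n) xs"
  by (simp add: lincomb_def coeff_sum coeff_poly_scale_const[OF assms])

lemma lincomb_poly_scale_quadratic:
  assumes "Modules.module s"
  shows "lincomb (poly_scale s) (\<lambda>i. [:a i, b i, c i:]) (const_polys xs)
    = [:lincomb s a xs, lincomb s b xs, lincomb s c xs:]"
proof -
  interpret Modules.module s by fact
  show ?thesis
    by (rule poly_eqI)
      (simp add: coeff_lincomb_poly_scale[OF assms] coeff_pCons lincomb_def[of _ "\<lambda>_. 0"]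
        split: nat.splits)
qed

lemma in_span_poly_scaleI:
  assumes s: "Modules.module s" and coeffs: "\<And>n. coeff q n \<in> module.span s (set xs)"
  shows "q \<in> module.span (poly_scale s) ((\<lambda>x. [:x:]) ` set xs)"
proof -
  interpret Modules.module s by fact
  interpret poly: Modules.module "poly_scale s" by (rule module_poly_scale[OF s])
  have "\<exists>c. coeff q n = lincomb s c xs" for n
    using coeffs[of n] unfolding span_set by blast
  then obtain c where c: "coeff q n = lincomb s (c n) xs" for n by metis
  define p where "p i = (\<Sum>n\<le>degree q. monom (c n i) n)" for i
  have p: "coeff (p i) n = (if n \<le> degree q then c n i else 0)" for i n
    by (simp add: p_def coeff_sum)
  have "q = lincomb (poly_scale s) p (const_polys xs)"
  proof (rule poly_eqI)
    fix n
    show "coeff q n = coeff (lincomb (poly_scale s) p (const_polys xs)) n"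
      by (cases "n \<le> degree q")
        (simp_all add: coeff_lincomb_poly_scale[OF s] p c[symmetric] lincomb_def[of _ "\<lambda>_. 0"]
          coeff_eq_0)
  qed
  then show ?thesis
    using poly.span_set[of "const_polys xs"] by auto
qed

lemma module_hom_map_poly:
  assumes "module_hom s s L"
  shows "module_hom (poly_scale s) (poly_scale s) (map_poly L)"
proof -
  interpret L: module_hom s s L by fact
  have s: "Modules.module s" by unfold_locales
  interpret Modules.module "poly_scale s" by (rule module_poly_scale[OF s])
  show ?thesis
    by unfold_locales
      (auto intro!: poly_eqI simp: coeff_map_poly coeff_poly_scale[OF s] L.add L.sum L.scale)
qed

lemma module_hom_pCons_0:
  assumes s: "Modules.module s"
  shows "module_hom (poly_scale s) (poly_scale s) (pCons 0)"
proof -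
  interpret s: Modules.module s by fact
  interpret Modules.module "poly_scale s" by (rule module_poly_scale[OF s])
  show ?thesis
  proof unfold_locales
    fix p q
    show "pCons 0 (poly_scale s p q) = poly_scale s p (pCons 0 q)"
    proof (rule poly_eqI)
      fix n
      have "(\<Sum>i\<le>k. s (coeff p i) (coeff (pCons 0 q) (Suc k - i)))
          = (\<Sum>i\<le>k. s (coeff p i) (coeff q (k - i)))" for k
        by (rule sum.cong) (auto simp: Suc_diff_le)
      then show "coeff (pCons 0 (poly_scale s p q)) n = coeff (poly_scale s p (pCons 0 q)) n"
        by (cases n) (simp_all add: coeff_poly_scale[OF s])
    qed
  qed simp
qed

lemma module_hom_ihara_op:
  assumes "module_hom s s (adj_op Y)" "module_hom s s (deg_op Y)"
  shows "module_hom (poly_scale s) (poly_scale s) (ihara_op Y)"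
proof -
  interpret adj: module_hom s s "adj_op Y" by fact
  have s: "Modules.module s" by unfold_locales
  interpret const: module_pair s s by unfold_locales
  interpret poly: module_pair "poly_scale s" "poly_scale s"
    using module_poly_scale[OF s] by (simp add: module_pair_def)
  have pCons_0: "module_hom (poly_scale s) (poly_scale s) (\<lambda>q. pCons 0 (h q))"
    if "module_hom (poly_scale s) (poly_scale s) h" for h
    using module_hom_compose[OF that module_hom_pCons_0[OF s]] by (simp add: comp_def)
  have "module_hom s s (\<lambda>x. deg_op Y x - x)"
    by (rule const.module_hom_sub[OF assms(2) adj.m1.module_hom_ident])
  note quadratic = pCons_0[OF pCons_0[OF module_hom_map_poly[OF this]]]
  have linear: "module_hom (poly_scale s) (poly_scale s) (\<lambda>q. pCons 0 (map_poly (adj_op Y) q))"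
    by (rule pCons_0[OF module_hom_map_poly[OF assms(1)]])
  show ?thesis
    unfolding ihara_op_def[abs_def]
    by (rule poly.module_hom_add[OF poly.module_hom_sub[OF poly.m1.module_hom_ident linear] quadratic])
qed

lemma represents_ihara_op:
  assumes adj: "module_hom s s (adj_op Y)" and deg: "module_hom s s (deg_op Y)"
    and P: "represents s xs xs (adj_op Y) P" and Q: "represents s xs xs (deg_op Y) Q"
  shows "represents (poly_scale s) (const_polys xs) (const_polys xs) (ihara_op Y)
    (ihara_mat (length xs) P Q)"
proof -
  interpret adj: module_hom s s "adj_op Y" by fact
  interpret deg: module_hom s s "deg_op Y" by fact
  have s: "Modules.module s" by unfold_locales
  have carrier: "P \<in> carrier_mat (length xs) (length xs)" "Q \<in> carrier_mat (length xs) (length xs)"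
    using P Q by (simp_all add: represents_def)
  have "ihara_op Y [:xs ! j:]
      = lincomb (poly_scale s) (\<lambda>i. ihara_mat (length xs) P Q $$ (i, j)) (const_polys xs)"
    if j: "j < length xs" for j
  proof -
    let ?\<delta> = "\<lambda>i. if i = j then 1 else 0"
    have "lincomb (poly_scale s) (\<lambda>i. ihara_mat (length xs) P Q $$ (i, j)) (const_polys xs)
        = lincomb (poly_scale s) (\<lambda>i. [:?\<delta> i, - P $$ (i, j), Q $$ (i, j) - ?\<delta> i:]) (const_polys xs)"
      using j carrier by (intro lincomb_cong) (simp add: index_ihara_mat)
    also have "\<dots> = [:xs ! j, - adj_op Y (xs ! j), deg_op Y (xs ! j) - xs ! j:]"
      using P Q j
      by (simp add: lincomb_poly_scale_quadratic[OF s] adj.m1.lincomb_unit adj.m1.lincomb_diff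
          adj.m1.lincomb_uminus represents_def)
    also have "\<dots> = ihara_op Y [:xs ! j:]"
      by (simp add: ihara_op_def Polynomial.map_poly_pCons adj.zero deg.zero)
    finally show ?thesis by simp
  qed
  then show ?thesis by (simp add: represents_def)
qed

section \<open>Equivariant operators on the derived graph\<close>

lemma lin_ext_add: "lin_ext F (x + y) = lin_ext F x + lin_ext F y"
proof -
  interpret Modules.module pm_scale by (rule module_pm_scale)
  show ?thesis
    unfolding lin_ext_def by (rule setsum_keys_plus_distrib) (simp_all add: scale_left_distrib)
qed

lemma lin_ext_single: "lin_ext F (Poly_Mapping.single w c) = pm_scale c (F w)"
proof -
  interpret Modules.module pm_scale by (rule module_pm_scale)
  show ?thesis by (simp add: lin_ext_def)
qed

lemma group_ring_scale_pm_scale: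
  fixes x :: "'w \<Rightarrow>\<^sub>0 complex"
  shows "group_ring_scale act (Poly_Mapping.single \<tau> c) (pm_scale d x) =
     pm_scale (c * d) (group_ring_scale act (Poly_Mapping.single \<tau> 1) x)"
proof -
  interpret Modules.module "pm_scale :: complex \<Rightarrow> ('w \<Rightarrow>\<^sub>0 complex) \<Rightarrow> _" by (rule module_pm_scale)
  show ?thesis
    by (induction x rule: poly_mapping_single_induct)
      (simp_all add: pm_scale_single group_ring_scale_single scale_right_distrib
        group_ring_scale_add_right mult.assoc)
qed

lemma module_hom_lin_ext:
  fixes act :: "'g::ab_group_add \<Rightarrow> 'w \<Rightarrow> 'w"
  assumes act: "\<And>w. act 0 w = w" "\<And>a b w. act (a + b) w = act a (act b w)"
    and F: "\<And>\<tau> w. F (act \<tau> w) = group_ring_scale act (Poly_Mapping.single \<tau> 1) (F w)"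
  shows "module_hom (group_ring_scale act) (group_ring_scale act) (lin_ext F)"
proof -
  interpret Modules.module "group_ring_scale act" by (rule module_group_ring_scale[OF act])
  show ?thesis
  proof unfold_locales
    fix a x
    show "lin_ext F (group_ring_scale act a x) = group_ring_scale act a (lin_ext F x)"
    proof (induction a rule: poly_mapping_single_induct)
      case (single \<tau> c)
      show ?case
        by (induction x rule: poly_mapping_single_induct)
          (simp_all add: group_ring_scale_single lin_ext_single F group_ring_scale_pm_scale
            lin_ext_add group_ring_scale_add_right)
    qed (simp add: lin_ext_add group_ring_scale_add_left)
  qed (rule lin_ext_add)
qed

definition edges_from :: "('v, 'e) sgraph \<Rightarrow> 'v \<Rightarrow> 'e set" where
  "edges_from X w = {e \<in> dedges X. orig X e = w}"

lemma val_conv_edges_from: "val X w = card (edges_from X w)"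
  by (simp add: val_def edges_from_def)

lemma adj_op_conv_edges_from:
  "adj_op Y = lin_ext (\<lambda>w. \<Sum>e\<in>edges_from Y w. Poly_Mapping.single (termin Y e) 1)"
  by (simp add: adj_op_def edges_from_def)

lemma edges_from_derived_graph:
  "edges_from (derived_graph X H \<alpha>) (w, S) = {(s, \<sigma>). s \<in> edges_from X w \<and> coset \<sigma> (H w) = S}"
  by (auto simp: edges_from_def derived_graph_def)

lemma bij_betw_edges_from_vertex_act:
  "bij_betw (\<lambda>(s, \<sigma>). (s, \<tau> + \<sigma>)) (edges_from (derived_graph X H \<alpha>) w)
     (edges_from (derived_graph X H \<alpha>) (vertex_act \<tau> w))"
proof (rule bij_betw_byWitness[where f' = "\<lambda>(s, \<sigma>). (s, \<sigma> - \<tau>)"])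
  obtain w0 S where w: "w = (w0, S)" by (cases w)
  have shift: "coset (\<sigma> - \<tau>) T = S" if "coset \<sigma> T = coset \<tau> S" for \<sigma> T
    using that coset_cancel[of \<tau> "coset (\<sigma> - \<tau>) T" S] by (simp add: coset_coset)
  show "(\<lambda>(s, \<sigma>). (s, \<tau> + \<sigma>)) ` edges_from (derived_graph X H \<alpha>) w
      \<subseteq> edges_from (derived_graph X H \<alpha>) (vertex_act \<tau> w)"
    by (auto simp: w vertex_act_def edges_from_derived_graph coset_coset)
  show "(\<lambda>(s, \<sigma>). (s, \<sigma> - \<tau>)) ` edges_from (derived_graph X H \<alpha>) (vertex_act \<tau> w)
      \<subseteq> edges_from (derived_graph X H \<alpha>) w"
    by (auto simp: w vertex_act_def edges_from_derived_graph shift)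
qed auto

lemma termin_derived_graph_shift:
  "termin (derived_graph X H \<alpha>) (s, \<tau> + \<sigma>) = vertex_act \<tau> (termin (derived_graph X H \<alpha>) (s, \<sigma>))"
  by (simp add: derived_graph_def vertex_act_def coset_coset add.assoc)

lemma module_hom_adj_op:
  "module_hom vertex_scale vertex_scale (adj_op (derived_graph X H \<alpha>))"
  unfolding adj_op_conv_edges_from
proof (rule module_hom_lin_ext[OF vertex_act_0 vertex_act_add])
  fix \<tau> w
  let ?Y = "derived_graph X H \<alpha>"
  interpret Modules.module vertex_scale by (rule module_vertex_scale)
  have "(\<Sum>e\<in>edges_from ?Y (vertex_act \<tau> w). Poly_Mapping.single (termin ?Y e) (1::complex))
      = (\<Sum>e\<in>edges_from ?Y w. Poly_Mapping.single (termin ?Y (case e of (s, \<sigma>) \<Rightarrow> (s, \<tau> + \<sigma>))) 1)"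
    by (rule sum.reindex_bij_betw[OF bij_betw_edges_from_vertex_act, symmetric])
  also have "\<dots> = (\<Sum>e\<in>edges_from ?Y w. Poly_Mapping.single (vertex_act \<tau> (termin ?Y e)) 1)"
    by (rule sum.cong) (auto simp: termin_derived_graph_shift)
  finally show "(\<Sum>e\<in>edges_from ?Y (vertex_act \<tau> w). Poly_Mapping.single (termin ?Y e) (1::complex))
      = vertex_scale (Poly_Mapping.single \<tau> 1)
          (\<Sum>e\<in>edges_from ?Y w. Poly_Mapping.single (termin ?Y e) 1)"
    by (simp add: scale_sum_right group_ring_scale_single)
qed

lemma module_hom_deg_op:
  "module_hom vertex_scale vertex_scale (deg_op (derived_graph X H \<alpha>))"
  unfolding deg_op_def
proof (rule module_hom_lin_ext[OF vertex_act_0 vertex_act_add])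
  fix \<tau> w
  have "val (derived_graph X H \<alpha>) (vertex_act \<tau> w) = val (derived_graph X H \<alpha>) w"
    unfolding val_conv_edges_from
    using bij_betw_same_card[OF bij_betw_edges_from_vertex_act] by metis
  then show "Poly_Mapping.single (vertex_act \<tau> w) (of_nat (val (derived_graph X H \<alpha>) (vertex_act \<tau> w)))
    = vertex_scale (Poly_Mapping.single \<tau> 1)
        (Poly_Mapping.single w (of_nat (val (derived_graph X H \<alpha>) w)))"
    by (simp add: group_ring_scale_single)
qed

section \<open>The determinant \<open>\<eta>\<^sub>Y\<close> as a matrix determinant\<close>

lemma C_mat_conv_mat_diag: "C_mat g v H = mat_diag g (\<lambda>i. \<Sum>a\<in>H (v i). Poly_Mapping.single a 1)"
  unfolding C_mat_def mat_diag_def by (rule eq_matI) auto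

lemma voltage_mats_carrier [simp]:
  "A_mat g v X \<alpha> \<in> carrier_mat g g" "C_mat g v H \<in> carrier_mat g g" "D_mat g v X \<in> carrier_mat g g"
  by (simp_all add: A_mat_def C_mat_def D_mat_def)

definition AC_mat ::
  "nat \<Rightarrow> (nat \<Rightarrow> 'v) \<Rightarrow> ('v, 'e) sgraph \<Rightarrow> ('v \<Rightarrow> 'g::ab_group_add set) \<Rightarrow> ('e \<Rightarrow> 'g)
     \<Rightarrow> ('g \<Rightarrow>\<^sub>0 int) mat" where
  "AC_mat g v X H \<alpha> = A_mat g v X \<alpha> * C_mat g v H"

definition DC_mat ::
  "nat \<Rightarrow> (nat \<Rightarrow> 'v) \<Rightarrow> ('v, 'e) sgraph \<Rightarrow> ('v \<Rightarrow> 'g::ab_group_add set) \<Rightarrow> ('g \<Rightarrow>\<^sub>0 int) mat" where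
  "DC_mat g v X H = D_mat g v X * C_mat g v H"

lemma AC_DC_mat_carrier [simp]:
  "AC_mat g v X H \<alpha> \<in> carrier_mat g g" "DC_mat g v X H \<in> carrier_mat g g"
  by (rule carrier_matI; simp add: AC_mat_def DC_mat_def A_mat_def C_mat_def D_mat_def)+

lemma dim_AC_DC_mat [simp]:
  "dim_row (AC_mat g v X H \<alpha>) = g" "dim_col (AC_mat g v X H \<alpha>) = g"
  "dim_row (DC_mat g v X H) = g" "dim_col (DC_mat g v X H) = g"
  by (simp_all add: AC_mat_def DC_mat_def A_mat_def C_mat_def D_mat_def)

lemma index_AC_mat:
  assumes "i < g" "j < g"
  shows "AC_mat g v X H \<alpha> $$ (i, j)
    = (\<Sum>s\<in>{s \<in> edges_from X (v j). termin X s = v i}. \<Sum>a\<in>H (v j). Poly_Mapping.single (\<alpha> s + a) 1)"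
  using assms unfolding AC_mat_def C_mat_conv_mat_diag mat_diag_mult_right[OF voltage_mats_carrier(1)]
  by (simp add: A_mat_def sum_product mult_single edges_from_def conj_assoc)

lemma index_DC_mat:
  assumes "i < g" "j < g"
  shows "DC_mat g v X H $$ (i, j)
    = (if i = j then \<Sum>a\<in>H (v j). Poly_Mapping.single a (of_nat (val X (v j))) else 0)"
  using assms unfolding DC_mat_def C_mat_conv_mat_diag mat_diag_mult_right[OF voltage_mats_carrier(3)]
  by (simp add: D_mat_def sum_distrib_left mult_single flip: single_of_nat)

locale labelled_graph =
  fixes X :: "('v, 'e) sgraph"
    and g :: nat
    and v :: "nat \<Rightarrow> 'v"
    and H :: "'v \<Rightarrow> 'g::{finite, ab_group_add} set"
    and \<alpha> :: "'e \<Rightarrow> 'g"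
  assumes finite_graph: "finite_graph X"
    and labelling: "bij_betw v {0..<g} (verts X)"
    and subgroup: "\<And>w. w \<in> verts X \<Longrightarrow> is_subgroup (H w)"
begin

abbreviation Y :: "('v \<times> 'g set, 'e \<times> 'g) sgraph" where "Y \<equiv> derived_graph X H \<alpha>"

abbreviation complexify :: "('g \<Rightarrow>\<^sub>0 int) \<Rightarrow> ('g \<Rightarrow>\<^sub>0 complex)" where
  "complexify \<equiv> Poly_Mapping.map of_int"

sublocale complexify: comm_ring_hom complexify
  by (rule comm_ring_hom_map_poly_mapping) unfold_locales

lemma complexify_single [simp]:
  "complexify (Poly_Mapping.single a c) = Poly_Mapping.single a (of_int c)"
  by (rule map_single) simp

definition base_vertices :: "('v \<times> 'g set \<Rightarrow>\<^sub>0 complex) list" where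
  "base_vertices = map (\<lambda>i. Poly_Mapping.single (v i, H (v i)) 1) [0..<g]"

lemma length_base_vertices [simp]: "length base_vertices = g"
  by (simp add: base_vertices_def)

lemma nth_base_vertices: "i < g \<Longrightarrow> base_vertices ! i = Poly_Mapping.single (v i, H (v i)) 1"
  by (simp add: base_vertices_def)

lemma v_in_verts: "i < g \<Longrightarrow> v i \<in> verts X"
  using labelling by (auto simp: bij_betw_def)

lemma v_eq_iff: "i < g \<Longrightarrow> j < g \<Longrightarrow> v i = v j \<longleftrightarrow> i = j"
  using labelling by (auto simp: bij_betw_def inj_on_def)

lemma subgroup_v: "i < g \<Longrightarrow> is_subgroup (H (v i))"
  by (intro subgroup v_in_verts)

lemma lincomb_base_vertices_eq_0:
  assumes "lincomb vertex_scale c base_vertices = 0" "i < g"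
  shows "c i * average (H (v i)) = 0"
proof (rule poly_mapping_eqI)
  fix \<sigma>
  let ?w = "(v i, coset \<sigma> (H (v i)))"
  have "0 = (\<Sum>k<g. Poly_Mapping.lookup (vertex_scale (c k) (base_vertices ! k)) ?w)"
    using assms(1) by (simp add: lincomb_def flip: lookup_sum)
  also have "\<dots> = (\<Sum>k<g. if k = i
      then Poly_Mapping.lookup (vertex_scale (c i) (base_vertices ! i)) ?w else 0)"
    by (rule sum.cong)
      (use assms(2) in \<open>auto simp: nth_base_vertices lookup_vertex_scale_other_fibre v_eq_iff\<close>)
  finally have "Poly_Mapping.lookup (vertex_scale (c i) (base_vertices ! i)) ?w = 0"
    using assms(2) by simp
  then show "Poly_Mapping.lookup (c i * average (H (v i))) \<sigma> = Poly_Mapping.lookup 0 \<sigma>"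
    using assms(2) by (simp add: lookup_mult_average[OF subgroup_v, of _ _ _ "v i"] nth_base_vertices)
qed

lemma C0_subset_span_base_vertices: "C0 Y \<subseteq> module.span vertex_scale (set base_vertices)"
proof
  interpret Modules.module vertex_scale by (rule module_vertex_scale)
  fix x assume "x \<in> C0 Y"
  then have keys: "Poly_Mapping.keys x \<subseteq> verts Y" by (simp add: C0_def)
  have "Poly_Mapping.single k c \<in> span (set base_vertices)" if k: "k \<in> verts Y" for k c
  proof -
    obtain w \<sigma> where "w \<in> verts X" "k = (w, coset \<sigma> (H w))"
      using k by (auto simp: derived_graph_def)
    moreover from this obtain i where i: "i < g" "w = v i"
      using labelling unfolding bij_betw_def by (metis atLeastLessThan_iff imageE)
    ultimately have
      "Poly_Mapping.single k c = vertex_scale (Poly_Mapping.single \<sigma> c) (base_vertices ! i)"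
      by (simp add: nth_base_vertices group_ring_scale_single vertex_act_def)
    then show ?thesis
      using i(1) by (simp add: span_scale span_base)
  qed
  then show "x \<in> span (set base_vertices)"
    using keys by (subst sum_single_lookup[symmetric], intro span_sum) auto
qed

lemma span_base_vertices:
  "module.span (poly_scale vertex_scale) ((\<lambda>x. [:x:]) ` set base_vertices) = C0_poly Y"
proof
  interpret poly: Modules.module "poly_scale vertex_scale"
    by (rule module_poly_scale[OF module_vertex_scale])
  have "[:x:] \<in> C0_poly Y" if x: "x \<in> set base_vertices" for x
  proof -
    obtain i where i: "i < g" "x = Poly_Mapping.single (v i, coset 0 (H (v i))) 1"
      using x by (auto simp: base_vertices_def coset_0)
    then have "(v i, coset 0 (H (v i))) \<in> verts Y"
      using v_in_verts by (auto simp: derived_graph_def)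
    then show ?thesis
      by (auto simp: C0_poly_def C0_def i(2) coeff_pCons split: nat.splits)
  qed
  then show "poly.span ((\<lambda>x. [:x:]) ` set base_vertices) \<subseteq> C0_poly Y"
    by (intro poly.span_minimal subspace_C0_poly vertex_act_in_verts vertex_act_0 vertex_act_add) auto
  show "C0_poly Y \<subseteq> poly.span ((\<lambda>x. [:x:]) ` set base_vertices)"
    using C0_subset_span_base_vertices
    by (auto simp: C0_poly_def intro!: in_span_poly_scaleI[OF module_vertex_scale])
qed

lemma edges_from_base_vertex:
  assumes "j < g"
  shows "edges_from Y (v j, H (v j)) = edges_from X (v j) \<times> H (v j)"
  by (auto simp: edges_from_derived_graph coset_eq_self_iff[OF subgroup_v[OF assms]])

lemma represents_adj_op:
  "represents vertex_scale base_vertices base_vertices (adj_op Y)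
     (map_mat complexify (AC_mat g v X H \<alpha>))"
proof -
  interpret Modules.module vertex_scale by (rule module_vertex_scale)
  have "adj_op Y (base_vertices ! j)
      = lincomb vertex_scale (\<lambda>i. complexify (AC_mat g v X H \<alpha> $$ (i, j))) base_vertices"
    if j: "j < g" for j
  proof -
    let ?E = "edges_from X (v j)"
    let ?h = "\<lambda>s. \<Sum>a\<in>H (v j).
      Poly_Mapping.single (termin X s, coset (\<alpha> s + a) (H (termin X s))) (1::complex)"
    have fin: "finite ?E" "finite (verts X)" and termin: "termin X ` ?E \<subseteq> verts X"
      using finite_graph by (auto simp: edges_from_def finite_graph_def serre_graph_def)
    have "vertex_scale (complexify (AC_mat g v X H \<alpha> $$ (i, j))) (base_vertices ! i)
        = sum ?h {s \<in> ?E. termin X s = v i}" if "i < g" for i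
      using that j
      by (simp add: index_AC_mat complexify.hom_sum scale_sum_left nth_base_vertices
          group_ring_scale_single vertex_act_def)
    then have "lincomb vertex_scale (\<lambda>i. complexify (AC_mat g v X H \<alpha> $$ (i, j))) base_vertices
        = (\<Sum>i<g. sum ?h {s \<in> ?E. termin X s = v i})"
      by (simp add: lincomb_def)
    also have "\<dots> = (\<Sum>w\<in>verts X. sum ?h {s \<in> ?E. termin X s = w})"
      using sum.reindex_bij_betw[OF labelling, of "\<lambda>w. sum ?h {s \<in> ?E. termin X s = w}"]
      by (simp add: atLeast0LessThan)
    also have "\<dots> = sum ?h ?E"
      by (rule sum.group[OF fin termin])
    also have "\<dots> = (\<Sum>e\<in>?E \<times> H (v j). Poly_Mapping.single (termin Y e) 1)"
      unfolding sum.cartesian_product by (rule sum.cong) (auto simp: derived_graph_def add.commute)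
    also have "\<dots> = adj_op Y (base_vertices ! j)"
      using j by (simp add: adj_op_conv_edges_from nth_base_vertices lin_ext_single
          edges_from_base_vertex module.scale_one[OF module_pm_scale])
    finally show ?thesis by simp
  qed
  then show ?thesis by (simp add: represents_def lincomb_def)
qed

lemma represents_deg_op:
  "represents vertex_scale base_vertices base_vertices (deg_op Y)
     (map_mat complexify (DC_mat g v X H))"
proof -
  interpret Modules.module vertex_scale by (rule module_vertex_scale)
  have "deg_op Y (base_vertices ! j)
      = lincomb vertex_scale (\<lambda>i. complexify (DC_mat g v X H $$ (i, j))) base_vertices"
    if j: "j < g" for j
  proof -
    let ?d = "\<Sum>a\<in>H (v j). Poly_Mapping.single a (of_nat (val X (v j)))"
    have "val Y (v j, H (v j)) = val X (v j) * card (H (v j))"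
      unfolding val_conv_edges_from edges_from_base_vertex[OF j] by (rule card_cartesian_product)
    then have "deg_op Y (base_vertices ! j)
        = (\<Sum>a\<in>H (v j). Poly_Mapping.single (v j, H (v j)) (of_nat (val X (v j))))"
      using j by (intro poly_mapping_eqI)
        (simp add: deg_op_def nth_base_vertices lin_ext_single lookup_sum lookup_single when_def)
    also have "\<dots> = vertex_scale ?d (base_vertices ! j)"
      unfolding scale_sum_left nth_base_vertices[OF j]
      by (rule sum.cong)
        (simp_all add: group_ring_scale_single vertex_act_fixes[OF subgroup_v[OF j]])
    also have "\<dots> = lincomb vertex_scale (\<lambda>i. if i = j then ?d else 0) base_vertices"
      using j by (simp add: lincomb_unit)
    also have "\<dots> = lincomb vertex_scale (\<lambda>i. complexify (DC_mat g v X H $$ (i, j))) base_vertices"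
      using j by (intro lincomb_cong) (simp add: index_DC_mat complexify.hom_sum)
    finally show ?thesis .
  qed
  then show ?thesis by (simp add: represents_def lincomb_def)
qed

lemma eta_derived_graph:
  "eta vertex_act Y = det (corner_mat g (\<lambda>i. [:average (H (v i)):])
     (ihara_mat g (map_mat complexify (AC_mat g v X H \<alpha>))
       (map_mat complexify (DC_mat g v X H))))"
  (is "_ = det (corner_mat g ?E ?M)")
proof -
  let ?xs = "const_polys base_vertices"
  have "endo_det (poly_scale vertex_scale)
        (module.span (poly_scale vertex_scale) (set ?xs)) (ihara_op Y)
      = det (corner_mat (length ?xs) ?E ?M)"
  proof (rule endo_det_idempotent_generators)
    show "poly_scale vertex_scale (?E i) (?xs ! i) = ?xs ! i" if "i < length ?xs" for i
      using that
      by (intro poly_eqI)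
        (auto simp: coeff_poly_scale_const[OF module_vertex_scale] coeff_pCons nth_base_vertices
          vertex_scale_average[OF subgroup_v] module.scale_zero_left[OF module_vertex_scale]
          split: nat.splits)
    show "c i * ?E i = 0" if "lincomb (poly_scale vertex_scale) c ?xs = 0" "i < length ?xs" for c i
    proof (rule poly_eqI)
      fix n
      have "lincomb vertex_scale (\<lambda>i. coeff (c i) n) base_vertices = 0"
        using that(1) coeff_lincomb_poly_scale[OF module_vertex_scale, of c base_vertices n] by simp
      then show "coeff (c i * ?E i) n = coeff 0 n"
        using lincomb_base_vertices_eq_0[of "\<lambda>i. coeff (c i) n" i] that(2) by (simp add: mult.commute)
    qed
    show "represents (poly_scale vertex_scale) ?xs ?xs (ihara_op Y) ?M"
      using represents_ihara_op[OF module_hom_adj_op module_hom_deg_op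
          represents_adj_op represents_deg_op] by simp
  qed (fact module_poly_scale[OF module_vertex_scale]
      module_hom_ihara_op[OF module_hom_adj_op module_hom_deg_op])+
  then show ?thesis by (simp add: eta_def span_base_vertices)
qed

section \<open>Specialisation at a character\<close>

definition char_mat :: "('g \<Rightarrow> complex) \<Rightarrow> complex poly mat" where
  "char_mat \<psi> = ihara_mat g (map_mat (char_ext_int \<psi>) (AC_mat g v X H \<alpha>))
     (map_mat (char_ext_int \<psi>) (DC_mat g v X H))"

definition trivial_indices :: "('g \<Rightarrow> complex) \<Rightarrow> nat set" where
  "trivial_indices \<psi> = {i. i < g \<and> H (v i) \<subseteq> char_ker \<psi>}"

lemma char_mat_carrier [simp]: "char_mat \<psi> \<in> carrier_mat g g"
  by (simp add: char_mat_def)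

lemma trivial_indices_subset: "trivial_indices \<psi> \<subseteq> {..<g}"
  by (auto simp: trivial_indices_def)

lemma r0_conv_trivial_indices: "r0 g v H \<psi> = card ({..<g} - trivial_indices \<psi>)"
  unfolding r0_def by (rule arg_cong[of _ _ card]) (auto simp: trivial_indices_def)

lemma card_trivial_indices: "card (verts X) - r0 g v H \<psi> = card (trivial_indices \<psi>)"
proof -
  have "card (verts X) = g" using bij_betw_same_card[OF labelling] by simp
  moreover have "finite (trivial_indices \<psi>)" using trivial_indices_subset finite_subset by blast
  moreover have "card (trivial_indices \<psi>) \<le> g" using card_mono[OF _ trivial_indices_subset] by simp
  ultimately show ?thesis
    using trivial_indices_subset by (simp add: r0_conv_trivial_indices card_Diff_subset)
qed

lemma h_fun_conv_corner_mat:
  assumes \<psi>: "is_character \<psi>"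
  shows "h_fun X H \<alpha> \<psi> = det (corner_mat g (\<lambda>i. of_bool (i \<in> trivial_indices \<psi>)) (char_mat \<psi>))"
proof -
  interpret \<psi>: comm_ring_hom "char_ext \<psi>" by (rule comm_ring_hom_char_ext[OF \<psi>])
  interpret poly: map_poly_comm_ring_hom "char_ext \<psi>" ..
  let ?P = "map_mat complexify (AC_mat g v X H \<alpha>)"
  let ?Q = "map_mat complexify (DC_mat g v X H)"
  have average: "map_poly (char_ext \<psi>) [:average (H (v i)):] = of_bool (i \<in> trivial_indices \<psi>)"
    if "i < g" for i
    using that by (simp add: char_ext_average[OF \<psi> subgroup_v] trivial_indices_def
        Polynomial.map_poly_pCons)
  have "map_mat (char_ext \<psi>) (map_mat complexify A) = map_mat (char_ext_int \<psi>) A" for A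
    by (rule eq_matI) (simp_all add: char_ext_int_def)
  then have ihara: "map_mat (map_poly (char_ext \<psi>)) (ihara_mat g ?P ?Q) = char_mat \<psi>"
    using \<psi>.map_ihara_mat[of ?P g ?Q] by (simp add: char_mat_def)
  have "h_fun X H \<alpha> \<psi>
      = det (corner_mat g (\<lambda>i. map_poly (char_ext \<psi>) [:average (H (v i)):]) (char_mat \<psi>))"
    unfolding h_fun_def eta_derived_graph poly.hom_det[symmetric] ihara[symmetric]
    by (simp add: poly.map_corner_mat)
  also have "\<dots> = det (corner_mat g (\<lambda>i. of_bool (i \<in> trivial_indices \<psi>)) (char_mat \<psi>))"
    by (rule arg_cong[of _ _ det], rule eq_matI) (simp_all add: index_corner_mat average)
  finally show ?thesis .
qed

lemma z_fun_conv_char_mat: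
  assumes "is_character \<psi>"
  shows "z_fun g v X H \<alpha> \<psi> = det (char_mat \<psi>)"
proof -
  interpret \<psi>: comm_ring_hom "char_ext_int \<psi>" by (rule comm_ring_hom_char_ext_int[OF assms])
  interpret poly: map_poly_comm_ring_hom "char_ext_int \<psi>" ..
  show ?thesis
    unfolding z_fun_def xi_def ihara_det_conv_ihara_mat AC_mat_def[where H = H, symmetric]
      DC_mat_def[symmetric] poly.hom_det[symmetric] char_mat_def
    by (simp add: \<psi>.map_ihara_mat)
qed

lemma char_mat_nontrivial_column:
  assumes \<psi>: "is_character \<psi>" and ij: "i < g" "j < g" and j: "j \<notin> trivial_indices \<psi>"
  shows "char_mat \<psi> $$ (i, j) = (if i = j then 1 - [:0, 1:]\<^sup>2 else 0)"
proof -
  interpret \<psi>: comm_ring_hom "char_ext_int \<psi>" by (rule comm_ring_hom_char_ext_int[OF \<psi>])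
  have vanish: "(\<Sum>a\<in>H (v j). \<psi> a) = 0"
    using j ij sum_character_subgroup[OF \<psi> subgroup_v[OF ij(2)]] by (simp add: trivial_indices_def)
  then have "char_ext_int \<psi> (AC_mat g v X H \<alpha> $$ (i, j)) = 0"
    using \<psi> ij
    by (simp add: index_AC_mat \<psi>.hom_sum is_character_def flip: sum_distrib_left)
  moreover have "char_ext_int \<psi> (DC_mat g v X H $$ (i, j)) = 0"
    using ij vanish by (simp add: index_DC_mat \<psi>.hom_sum flip: sum_distrib_left)
  ultimately show ?thesis
    using ij by (simp add: char_mat_def index_ihara_mat one_pCons power2_eq_square)
qed

lemma ihara_det_trim_conv_submatrix:
  assumes "is_character \<psi>"
  shows "ihara_det (card (trivial_indices \<psi>))
      (map_mat (char_ext_int \<psi>) (trim g v H \<psi> (A_mat g v X \<alpha>)))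
      (map_mat (char_ext_int \<psi>) (trim g v H \<psi> (C_mat g v H)))
      (map_mat (char_ext_int \<psi>) (trim g v H \<psi> (D_mat g v X)))
    = det (submatrix (char_mat \<psi>) (trivial_indices \<psi>) (trivial_indices \<psi>))"
proof -
  interpret \<psi>: comm_ring_hom "char_ext_int \<psi>" by (rule comm_ring_hom_char_ext_int[OF assms])
  let ?\<psi> = "map_mat (char_ext_int \<psi>)"
  let ?K = "trivial_indices \<psi>"
  note K = trivial_indices_subset[of \<psi>]
  have product: "?\<psi> (submatrix B ?K ?K) * ?\<psi> (submatrix (C_mat g v H) ?K ?K)
      = submatrix (?\<psi> (B * C_mat g v H)) ?K ?K" if B: "B \<in> carrier_mat g g" for B
  proof -
    have "?\<psi> (submatrix B ?K ?K) * ?\<psi> (submatrix (C_mat g v H) ?K ?K)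
        = ?\<psi> (submatrix B ?K ?K * submatrix (C_mat g v H) ?K ?K)"
      by (rule \<psi>.mat_hom_mult[OF submatrix_carrier[OF B K K]
          submatrix_carrier[OF voltage_mats_carrier(2) K K], symmetric])
    also have "\<dots> = ?\<psi> (submatrix (B * C_mat g v H) ?K ?K)"
      unfolding C_mat_conv_mat_diag submatrix_mult_mat_diag[OF B K] ..
    finally show ?thesis by (simp only: map_mat_submatrix)
  qed
  show ?thesis
    unfolding trim_def Let_def trivial_indices_def[symmetric] ihara_det_conv_ihara_mat char_mat_def
    by (simp add: product submatrix_ihara_mat[OF _ _ K] flip: AC_mat_def DC_mat_def)
qed

end

theorem theorem6p6:
  fixes X :: "('v, 'e) sgraph"
    and g :: nat
    and v :: "nat \<Rightarrow> 'v"
    and H :: "'v \<Rightarrow> 'g::{finite, ab_group_add} set"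
    and \<alpha> :: "'e \<Rightarrow> 'g"
    and \<psi> :: "'g \<Rightarrow> complex"
  assumes "finite_graph X"
    and "bij_betw v {0..<g} (verts X)"
    and "\<And>w. w \<in> verts X \<Longrightarrow> is_subgroup (H w)"
    and "voltage X \<alpha>"
    and "is_character \<psi>"
  shows "(1 - [:0, 1:]\<^sup>2) ^ r0 g v H \<psi> * h_fun X H \<alpha> \<psi> = z_fun g v X H \<alpha> \<psi> \<and>
         h_fun X H \<alpha> \<psi> =
           ihara_det (card (verts X) - r0 g v H \<psi>)
             (map_mat (char_ext_int \<psi>) (trim g v H \<psi> (A_mat g v X \<alpha>)))
             (map_mat (char_ext_int \<psi>) (trim g v H \<psi> (C_mat g v H)))
             (map_mat (char_ext_int \<psi>) (trim g v H \<psi> (D_mat g v X)))"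
proof
  interpret labelled_graph X g v H \<alpha> by (unfold_locales; fact assms)
  note h_fun = h_fun_conv_corner_mat[OF assms(5)]
  show "(1 - [:0, 1:]\<^sup>2) ^ r0 g v H \<psi> * h_fun X H \<alpha> \<psi> = z_fun g v X H \<alpha> \<psi>"
    unfolding h_fun z_fun_conv_char_mat[OF assms(5)] r0_conv_trivial_indices
    by (rule det_eq_power_mult_det_corner_mat[symmetric])
      (simp_all add: trivial_indices_subset char_mat_nontrivial_column[OF assms(5)])
  show "h_fun X H \<alpha> \<psi> = ihara_det (card (verts X) - r0 g v H \<psi>)
      (map_mat (char_ext_int \<psi>) (trim g v H \<psi> (A_mat g v X \<alpha>)))
      (map_mat (char_ext_int \<psi>) (trim g v H \<psi> (C_mat g v H)))
      (map_mat (char_ext_int \<psi>) (trim g v H \<psi> (D_mat g v X)))"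
    unfolding h_fun card_trivial_indices ihara_det_trim_conv_submatrix[OF assms(5)]
    by (rule det_submatrix_eq_det_corner_mat[symmetric]) (simp_all add: trivial_indices_subset)
qed

end
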